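(* For all $P_1,P_2,N>0$ and $\sigma_2^2\ge0$, $$\mathcal C_{\mathrm{MAC}}(P_1,P_2,N)\subsetneq\mathcal C_{\mathrm{NoisyPartialFB}}(P_1,P_2,N,\sigma_2^2),$$ i.e., the inclusion holds and is strict.
   Context: Channel model (noisy partial feedback). Fix $P_1,P_2,N>0$ and $\sigma_2^2\ge0$. Messages $M_1,M_2$ are independent and uniform on finite sets $\mathcal M_1,\mathcal M_2$. $\{Z_t\}$ is IID $\mathcal N(0,N)$, $\{W_{2,t}\}$ is IID $\mathcal N(0,\sigma_2^2)$, and $M_1,M_2,\{Z_t\},\{W_{2,t}\}$ are mutually independent. The output is $Y_t=X_{1,t}+X_{2,t}+Z_t$. Transmitter 1 has no feedback: $X_{1,t}=\varphi_{1,t}(M_1)$. Transmitter 2 observes causally $V_{2,t}=Y_t+W_{2,t}$: $X_{2,t}=\varphi_{2,t}(M_2,V_{2,1},\dots,V_{2,t-1})$. Encoders must satisfy $\frac1n\sum_{t=1}^n\mathbb E[X_{\nu,t}^2]\le P_\nu$, and the decoder is $\phi:\mathbb R^n\to\mathcal M_1\times\mathcal M_2$. Achievability of $(R_1,R_2)$: for every $\delta>0$ and all sufficiently large $n$ there is a blocklength-$n$ code with $\frac1n\log|\mathcal M_\nu|>R_\nu-\delta$ and error probability $\Pr[\phi(Y^n)\neq(M_1,M_2)]\to0$ as $n\to\infty$. $\mathcal C_{\mathrm{NoisyPartialFB}}(P_1,P_2,N,\sigma_2^2)$ is the set of achievable pairs. The no-feedback capacity region $\mathcal C_{\mathrm{MAC}}(P_1,P_2,N)$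 is the set of nonnegative $(R_1,R_2)$ with $R_1\le\frac12\log(1+\frac{P_1}{N})$, $R_2\le\frac12\log(1+\frac{P_2}{N})$, $R_1+R_2\le\frac12\log(1+\frac{P_1+P_2}{N})$. *)

theory Defs
  imports "HOL-Probability.Probability"
begin

text \<open>A blocklength code for the two-user Gaussian MAC with noisy partial feedback
to transmitter 2. Messages are M1 in {0..<nmsg1}, M2 in {0..<nmsg2}; time indices
are 0..n-1. enc2 t m v receives the feedback prefix v = (V_2,0..V_2,t-1) as a
function restricted (extensional) to {..<t}.\<close>

record fbcode =
  nmsg1 :: nat
  nmsg2 :: nat
  enc1 :: "nat \<Rightarrow> nat \<Rightarrow> real"
  enc2 :: "nat \<Rightarrow> nat \<Rightarrow> (nat \<Rightarrow> real) \<Rightarrow> real"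
  dec  :: "(nat \<Rightarrow> real) \<Rightarrow> nat \<times> nat"

text \<open>Channel output prefix (Y_0..Y_{t-1}), as a function extensional on {..<t}.
Noise: Z_t = sqrt N * g t, W_2t = sqrt s * h t with g, h IID standard normal.\<close>

fun chan_out :: "fbcode \<Rightarrow> real \<Rightarrow> real \<Rightarrow> nat \<Rightarrow> nat \<Rightarrow> (nat \<Rightarrow> real) \<Rightarrow> (nat \<Rightarrow> real)
    \<Rightarrow> nat \<Rightarrow> (nat \<Rightarrow> real)" where
  "chan_out c N s m1 m2 g h 0 = restrict (\<lambda>_. 0) {..<0}"
| "chan_out c N s m1 m2 g h (Suc t) =
     (let y = chan_out c N s m1 m2 g h t;
          v = restrict (\<lambda>i. y i + sqrt s * h i) {..<t}
      in y(t := enc1 c t m1 + enc2 c t m2 v + sqrt N * g t))"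

definition input2 :: "fbcode \<Rightarrow> real \<Rightarrow> real \<Rightarrow> nat \<Rightarrow> nat \<Rightarrow> (nat \<Rightarrow> real) \<Rightarrow> (nat \<Rightarrow> real)
    \<Rightarrow> nat \<Rightarrow> real" where
  "input2 c N s m1 m2 g h t =
     enc2 c t m2 (restrict (\<lambda>i. chan_out c N s m1 m2 g h t i + sqrt s * h i) {..<t})"

definition noise_space :: "nat \<Rightarrow> (nat \<Rightarrow> real) measure" where
  "noise_space n = PiM {..<n} (\<lambda>_. density lborel std_normal_density)"

definition code_space :: "fbcode \<Rightarrow> nat \<Rightarrow> ((nat \<times> nat) \<times> ((nat \<Rightarrow> real) \<times> (nat \<Rightarrow> real))) measure" where
  "code_space c n =
     uniform_measure (count_space UNIV) ({..<nmsg1 c} \<times> {..<nmsg2 c})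
       \<Otimes>\<^sub>M (noise_space n \<Otimes>\<^sub>M noise_space n)"

definition err_prob :: "fbcode \<Rightarrow> real \<Rightarrow> real \<Rightarrow> nat \<Rightarrow> real" where
  "err_prob c N s n = measure (code_space c n)
     {\<omega> \<in> space (code_space c n).
        dec c (chan_out c N s (fst (fst \<omega>)) (snd (fst \<omega>)) (fst (snd \<omega>)) (snd (snd \<omega>)) n)
          \<noteq> fst \<omega>}"

definition valid_code :: "fbcode \<Rightarrow> nat \<Rightarrow> real \<Rightarrow> real \<Rightarrow> real \<Rightarrow> real \<Rightarrow> bool" where
  "valid_code c n P1 P2 N s \<longleftrightarrow>
     nmsg1 c \<ge> 1 \<and> nmsg2 c \<ge> 1 \<and>
     (\<forall>t<n. \<forall>m. enc2 c t m \<in> borel_measurable (PiM {..<t} (\<lambda>_. borel))) \<and>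
     dec c \<in> measurable (PiM {..<n} (\<lambda>_. borel)) (count_space UNIV) \<and>
     (\<Sum>t<n. \<integral>\<^sup>+ \<omega>. ennreal ((enc1 c t (fst (fst \<omega>)))\<^sup>2) \<partial>code_space c n)
        \<le> ennreal (real n * P1) \<and>
     (\<Sum>t<n. \<integral>\<^sup>+ \<omega>. ennreal ((input2 c N s (fst (fst \<omega>)) (snd (fst \<omega>))
                                   (fst (snd \<omega>)) (snd (snd \<omega>)) t)\<^sup>2) \<partial>code_space c n)
        \<le> ennreal (real n * P2)"

definition achievable_fb :: "real \<Rightarrow> real \<Rightarrow> real \<Rightarrow> real \<Rightarrow> real \<Rightarrow> real \<Rightarrow> bool" where
  "achievable_fb P1 P2 N s R1 R2 \<longleftrightarrow>
     (\<forall>\<delta>>0. \<exists>C :: nat \<Rightarrow> fbcode.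
        (\<forall>\<^sub>F n in sequentially. valid_code (C n) n P1 P2 N s \<and>
            ln (real (nmsg1 (C n))) / real n > R1 - \<delta> \<and>
            ln (real (nmsg2 (C n))) / real n > R2 - \<delta>) \<and>
        (\<lambda>n. err_prob (C n) N s n) \<longlonglongrightarrow> 0)"

definition C_NoisyPartialFB :: "real \<Rightarrow> real \<Rightarrow> real \<Rightarrow> real \<Rightarrow> (real \<times> real) set" where
  "C_NoisyPartialFB P1 P2 N s =
     {(R1, R2). R1 \<ge> 0 \<and> R2 \<ge> 0 \<and> achievable_fb P1 P2 N s R1 R2}"

definition C_MAC :: "real \<Rightarrow> real \<Rightarrow> real \<Rightarrow> (real \<times> real) set" where
  "C_MAC P1 P2 N =
     {(R1, R2). R1 \<ge> 0 \<and> R2 \<ge> 0 \<and>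
        R1 \<le> 1/2 * ln (1 + P1 / N) \<and> R2 \<le> 1/2 * ln (1 + P2 / N) \<and>
        R1 + R2 \<le> 1/2 * ln (1 + (P1 + P2) / N)}"

end

theory Submission
  imports Defs
begin

text \<open>
  The time axis is cut into blocks of two channel uses. In the first use the transmitters send
  independent Gaussian symbols \<open>u\<close> and \<open>v\<close>; in the second use each adds a multiple of its old symbol
  to a fresh one, with opposite correlations chosen so that the two received sums are uncorrelated,
  and transmitter 2 moreover adds \<open>\<alpha>\<close> times its feedback of the first use. The receiver cancels
  \<open>\<alpha> y\<close>, which leaves a channel without feedback whose second noise has variance
  \<open>N + \<alpha>\<^sup>2 s\<close>. Because the old symbol of transmitter 2 enters the second use with negative sign,
  the feedback term lowers its energy at first order in \<open>\<alpha>\<close>, while noise and energy increase only at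
  second order; so a small \<open>\<alpha> > 0\<close> raises the sum rate. For \<open>\<alpha> = 0\<close> and uncorrelated
  uses the scheme reaches the whole region without feedback.

  Achievability is random coding with a threshold decoder. Its three scores are scaled likelihood
  ratios, whose integrals against an independent codeword are known exactly, so wrong messages are
  handled by Markov's inequality; the true message and the energies are handled by Chernoff bounds
  for sums of squares of linear forms in independent normals.
\<close>

section \<open>The standard normal distribution\<close>

abbreviation std_normal :: "real measure" where
  "std_normal \<equiv> density lborel (\<lambda>x. ennreal (std_normal_density x))"

lemma prob_space_std_normal: "prob_space std_normal"
  using prob_space_normal_density[of 1 0] by simp

lemma sets_std_normal [measurable_cong]: "sets std_normal = sets borel"
  by simp

lemma nn_integral_std_normal:
  "f \<in> borel_measurable borel \<Longrightarrow>
    (\<integral>\<^sup>+u. f u \<partial>std_normal) = (\<integral>\<^sup>+u. ennreal (std_normal_density u) * f u \<partial>lborel)"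
  by (subst nn_integral_density) auto

lemma std_normal_density_rotation:
  assumes "a\<^sup>2 + b\<^sup>2 = 1"
  shows "std_normal_density (a * u + b * v) * std_normal_density (a * v - b * u)
    = std_normal_density u * std_normal_density v"
proof -
  have "(a * u + b * v)\<^sup>2 + (a * v - b * u)\<^sup>2 = (a\<^sup>2 + b\<^sup>2) * (u\<^sup>2 + v\<^sup>2)"
    by (simp add: power2_eq_square algebra_simps)
  then have "exp (- ((a * u + b * v)\<^sup>2) / 2) * exp (- ((a * v - b * u)\<^sup>2) / 2)
      = exp (- (u\<^sup>2) / 2) * exp (- (v\<^sup>2) / 2)"
    by (simp add: assms exp_add[symmetric] add_divide_distrib[symmetric])
  then show ?thesis by (simp add: std_normal_density_def)
qed

lemma nn_integral_std_normal_exp_square: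
  fixes p :: real
  assumes "p < 1/2"
  shows "(\<integral>\<^sup>+u. ennreal (exp (p * u\<^sup>2)) \<partial>std_normal) = ennreal (1 / sqrt (1 - 2 * p))"
proof -
  define \<sigma> where "\<sigma> = 1 / sqrt (1 - 2 * p)"
  have \<sigma>_pos: "0 < \<sigma>" and \<sigma>_square: "\<sigma>\<^sup>2 = 1 / (1 - 2 * p)"
    using assms by (simp_all add: \<sigma>_def power_divide)
  have "std_normal_density u * exp (p * u\<^sup>2) = \<sigma> * normal_density 0 \<sigma> u" for u
  proof -
    have "- (u\<^sup>2) / 2 + p * u\<^sup>2 = - (u\<^sup>2) / (2 * \<sigma>\<^sup>2)"
      using assms by (simp add: \<sigma>_square field_simps)
    then show ?thesis
      using \<sigma>_pos by (simp add: normal_density_def real_sqrt_mult exp_add[symmetric])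
  qed
  then have "(\<integral>\<^sup>+u. ennreal (exp (p * u\<^sup>2)) \<partial>std_normal)
      = (\<integral>\<^sup>+u. ennreal \<sigma> * ennreal (normal_density 0 \<sigma> u) \<partial>lborel)"
    using \<sigma>_pos by (subst nn_integral_std_normal) (auto simp: ennreal_mult[symmetric])
  also have "\<dots> = ennreal \<sigma>"
    using prob_space.emeasure_space_1[OF prob_space_normal_density[OF \<sigma>_pos, of 0]]
    by (simp add: nn_integral_cmult emeasure_density)
  finally show ?thesis by (simp add: \<sigma>_def)
qed

lemma nn_integral_lborel_reflect:
  fixes a :: real
  assumes "\<bar>a\<bar> = 1" "f \<in> borel_measurable borel"
  shows "(\<integral>\<^sup>+x. f (a * x) \<partial>lborel) = (\<integral>\<^sup>+x. f x \<partial>lborel)"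
  using nn_integral_real_affine[OF assms(2), of a 0] assms(1) by force

lemma nn_integral_lborel_rotation:
  fixes f :: "real \<Rightarrow> real \<Rightarrow> ennreal"
  assumes [measurable]: "(\<lambda>(u, v). f u v) \<in> borel_measurable (borel \<Otimes>\<^sub>M borel)"
    and unit: "a\<^sup>2 + b\<^sup>2 = 1"
  shows "(\<integral>\<^sup>+u. \<integral>\<^sup>+v. f (a * u + b * v) (a * v - b * u) \<partial>lborel \<partial>lborel)
    = (\<integral>\<^sup>+u. \<integral>\<^sup>+v. f u v \<partial>lborel \<partial>lborel)"
proof (cases "b = 0")
  case True
  then have "\<bar>a\<bar> = 1" using unit by (auto simp: power2_eq_1_iff)
  note reflect = nn_integral_lborel_reflect[OF this]
  have "(\<integral>\<^sup>+u. \<integral>\<^sup>+v. f (a * u + b * v) (a * v - b * u) \<partial>lborel \<partial>lborel)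
      = (\<integral>\<^sup>+u. \<integral>\<^sup>+v. f (a * u) v \<partial>lborel \<partial>lborel)"
    using True by (simp add: reflect)
  also have "\<dots> = (\<integral>\<^sup>+u. \<integral>\<^sup>+v. f u v \<partial>lborel \<partial>lborel)"
    by (rule reflect) measurable
  finally show ?thesis .
next
  case False
  have "(\<integral>\<^sup>+u. \<integral>\<^sup>+v. f (a * u + b * v) (a * v - b * u) \<partial>lborel \<partial>lborel)
      = (\<integral>\<^sup>+u. \<bar>1 / b\<bar> * (\<integral>\<^sup>+p. f p ((a * p - u) / b) \<partial>lborel) \<partial>lborel)"
  proof (intro nn_integral_cong)
    fix u
    let ?v = "\<lambda>p. - a * u / b + 1 / b * p"
    have "a * u + b * ?v p = p" for p using False by (simp add: field_simps)
    moreover have "a * ?v p - b * u = (a * p - (a\<^sup>2 + b\<^sup>2) * u) / b" for p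
      using False by (simp add: field_simps power2_eq_square)
    ultimately show "(\<integral>\<^sup>+v. f (a * u + b * v) (a * v - b * u) \<partial>lborel)
        = \<bar>1 / b\<bar> * (\<integral>\<^sup>+p. f p ((a * p - u) / b) \<partial>lborel)"
      using False unit by (subst nn_integral_real_affine[of _ "1 / b" "- a * u / b"]) simp_all
  qed
  also have "\<dots> = \<bar>1 / b\<bar> * (\<integral>\<^sup>+u. \<integral>\<^sup>+p. f p ((a * p - u) / b) \<partial>lborel \<partial>lborel)"
    by (intro nn_integral_cmult) measurable
  also have "(\<integral>\<^sup>+u. \<integral>\<^sup>+p. f p ((a * p - u) / b) \<partial>lborel \<partial>lborel)
      = (\<integral>\<^sup>+p. \<integral>\<^sup>+u. f p ((a * p - u) / b) \<partial>lborel \<partial>lborel)"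
    by (intro lborel_pair.Fubini') measurable
  also have "\<dots> = (\<integral>\<^sup>+p. \<bar>b\<bar> * (\<integral>\<^sup>+q. f p q \<partial>lborel) \<partial>lborel)"
  proof (intro nn_integral_cong)
    fix p
    show "(\<integral>\<^sup>+u. f p ((a * p - u) / b) \<partial>lborel) = \<bar>b\<bar> * (\<integral>\<^sup>+q. f p q \<partial>lborel)"
      using False nn_integral_real_affine[of "\<lambda>u. f p ((a * p - u) / b)" "- b" "a * p"] by simp
  qed
  also have "\<dots> = \<bar>b\<bar> * (\<integral>\<^sup>+p. \<integral>\<^sup>+q. f p q \<partial>lborel \<partial>lborel)"
    by (intro nn_integral_cmult) measurable
  finally show ?thesis
    using False by (simp add: mult.assoc[symmetric] ennreal_mult[symmetric])
qed

lemma nn_integral_std_normal_rotation: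
  fixes f :: "real \<Rightarrow> real \<Rightarrow> ennreal" and a b :: real
  assumes [measurable]: "(\<lambda>(u, v). f u v) \<in> borel_measurable (borel \<Otimes>\<^sub>M borel)"
  defines "r \<equiv> sqrt (a\<^sup>2 + b\<^sup>2)"
  shows "(\<integral>\<^sup>+u. \<integral>\<^sup>+v. f (a * u + b * v) (a * v - b * u) \<partial>std_normal \<partial>std_normal)
    = (\<integral>\<^sup>+u. \<integral>\<^sup>+v. f (r * u) (r * v) \<partial>std_normal \<partial>std_normal)"
proof (cases "r = 0")
  case True
  then show ?thesis by (auto simp: r_def add_nonneg_eq_0_iff)
next
  case False
  define \<phi> where "\<phi> u v = ennreal (std_normal_density u) * ennreal (std_normal_density v)" for u v
  have lborel: "(\<integral>\<^sup>+u. \<integral>\<^sup>+v. F u v \<partial>std_normal \<partial>std_normal)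
      = (\<integral>\<^sup>+u. \<integral>\<^sup>+v. \<phi> u v * F u v \<partial>lborel \<partial>lborel)"
    if [measurable]: "(\<lambda>(u, v). F u v) \<in> borel_measurable (borel \<Otimes>\<^sub>M borel)" for F
    by (simp add: nn_integral_std_normal nn_integral_cmult \<phi>_def mult.assoc)
  define \<alpha> \<beta> where "\<alpha> = a / r" and "\<beta> = b / r"
  have scale: "a = r * \<alpha>" "b = r * \<beta>" using False by (simp_all add: \<alpha>_def \<beta>_def)
  have unit: "\<alpha>\<^sup>2 + \<beta>\<^sup>2 = 1"
    using False by (simp add: \<alpha>_def \<beta>_def power_divide add_divide_distrib[symmetric]) (simp add: r_def)
  have \<phi>_invariant: "\<phi> (\<alpha> * u + \<beta> * v) (\<alpha> * v - \<beta> * u) = \<phi> u v" for u v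
    using std_normal_density_rotation[OF unit, of u v] by (simp add: \<phi>_def ennreal_mult[symmetric])
  have "(\<integral>\<^sup>+u. \<integral>\<^sup>+v. f (a * u + b * v) (a * v - b * u) \<partial>std_normal \<partial>std_normal)
      = (\<integral>\<^sup>+u. \<integral>\<^sup>+v. \<phi> (\<alpha> * u + \<beta> * v) (\<alpha> * v - \<beta> * u) *
          f (r * (\<alpha> * u + \<beta> * v)) (r * (\<alpha> * v - \<beta> * u)) \<partial>lborel \<partial>lborel)"
    by (subst lborel)
      (simp_all add: \<phi>_invariant scale distrib_left right_diff_distrib mult.assoc split_beta')
  also have "\<dots> = (\<integral>\<^sup>+u. \<integral>\<^sup>+v. \<phi> u v * f (r * u) (r * v) \<partial>lborel \<partial>lborel)"
    by (rule nn_integral_lborel_rotation[OF _ unit]) (simp add: \<phi>_def split_beta')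
  also have "\<dots> = (\<integral>\<^sup>+u. \<integral>\<^sup>+v. f (r * u) (r * v) \<partial>std_normal \<partial>std_normal)"
    by (subst lborel) (simp_all add: split_beta')
  finally show ?thesis .
qed

definition gauss_mean :: "(real \<Rightarrow> ennreal) \<Rightarrow> real \<Rightarrow> real \<Rightarrow> ennreal" where
  "gauss_mean h v x = (\<integral>\<^sup>+u. h (x + sqrt v * u) \<partial>std_normal)"

lemma gauss_mean_measurable [measurable]:
  assumes [measurable]: "h \<in> borel_measurable borel"
  shows "gauss_mean h v \<in> borel_measurable borel"
proof -
  interpret prob_space std_normal by (rule prob_space_std_normal)
  show ?thesis unfolding gauss_mean_def by measurable
qed

lemma gauss_mean_0: "gauss_mean h 0 x = h x"
  using prob_space.emeasure_space_1[OF prob_space_std_normal] by (simp add: gauss_mean_def)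

lemma nn_integral_gauss_mean:
  assumes [measurable]: "h \<in> borel_measurable borel" and "0 \<le> v"
  shows "(\<integral>\<^sup>+u. gauss_mean h v (x + c * u) \<partial>std_normal) = gauss_mean h (v + c\<^sup>2) x"
proof -
  have "(\<integral>\<^sup>+u. gauss_mean h v (x + c * u) \<partial>std_normal)
      = (\<integral>\<^sup>+u. \<integral>\<^sup>+w. h (x + (c * u + sqrt v * w)) \<partial>std_normal \<partial>std_normal)"
    by (simp add: gauss_mean_def add.assoc)
  also have "\<dots> = (\<integral>\<^sup>+u. \<integral>\<^sup>+w. h (x + sqrt (c\<^sup>2 + (sqrt v)\<^sup>2) * u) \<partial>std_normal \<partial>std_normal)"
    by (rule nn_integral_std_normal_rotation[where f = "\<lambda>p q. h (x + p)"]) simp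
  also have "\<dots> = gauss_mean h (v + c\<^sup>2) x"
    using \<open>0 \<le> v\<close> prob_space.emeasure_space_1[OF prob_space_std_normal]
    by (simp add: gauss_mean_def add.commute)
  finally show ?thesis .
qed

lemma gauss_mean_exp_square:
  assumes "0 \<le> v" "2 * s * v < 1"
  shows "gauss_mean (\<lambda>x. ennreal (exp (s * x\<^sup>2))) v 0 = ennreal (1 / sqrt (1 - 2 * s * v))"
  using nn_integral_std_normal_exp_square[of "s * v"] assms
  by (simp add: gauss_mean_def power_mult_distrib mult.assoc)

lemma nn_integral_normal_density_mean:
  assumes "0 < \<sigma>"
  shows "(\<integral>\<^sup>+u. ennreal (normal_density (x + d * u) \<sigma> y) \<partial>std_normal)
    = ennreal (normal_density x (sqrt (\<sigma>\<^sup>2 + d\<^sup>2)) y)"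
proof (cases "d = 0")
  case True
  then show ?thesis
    using assms prob_space.emeasure_space_1[OF prob_space_std_normal] by simp
next
  case False
  have mean: "normal_density (x + d * u) \<sigma> y = normal_density 0 \<sigma> ((y - x) - d * u)" for u
    by (simp add: normal_density_def diff_diff_eq)
  have scale: "\<bar>d\<bar> * normal_density 0 \<bar>d\<bar> (d * u) = std_normal_density u" for u
    using False by (simp add: normal_density_def real_sqrt_mult power_mult_distrib)
  have "(\<integral>\<^sup>+u. ennreal (normal_density (x + d * u) \<sigma> y) \<partial>std_normal)
      = (\<integral>\<^sup>+u. \<bar>d\<bar> * ennreal (normal_density 0 \<sigma> ((y - x) - d * u) * normal_density 0 \<bar>d\<bar> (d * u))
          \<partial>lborel)"
    unfolding mean
    by (subst nn_integral_std_normal) (auto simp: scale[symmetric] ennreal_mult[symmetric] mult_ac)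
  also have "\<dots> = (\<integral>\<^sup>+t. ennreal (normal_density 0 \<sigma> ((y - x) - t) * normal_density 0 \<bar>d\<bar> t) \<partial>lborel)"
    using False by (subst (2) nn_integral_real_affine[of _ d 0]) (auto simp: nn_integral_cmult)
  also have "\<dots> = ennreal (normal_density 0 (sqrt (\<sigma>\<^sup>2 + d\<^sup>2)) (y - x))"
    using fun_cong[OF conv_normal_density_zero_mean[of \<sigma> "\<bar>d\<bar>"], of "y - x"] assms False by simp
  finally show ?thesis by (simp add: normal_density_def)
qed

section \<open>Likelihood ratios of Gaussian channels\<close>

text \<open>The output of the channel \<open>x \<mapsto> x + N(0,N)\<close> has the density in the denominator if its input is
  Gaussian of variance \<open>v\<close>.\<close>

definition lratio :: "real \<Rightarrow> real \<Rightarrow> real \<Rightarrow> real \<Rightarrow> real" where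
  "lratio N v x y = normal_density x (sqrt N) y / normal_density 0 (sqrt (N + v)) y"

lemma lratio_nonneg: "0 \<le> lratio N v x y"
  by (simp add: lratio_def)

lemma lratio_measurable [measurable]:
  assumes [measurable]: "f \<in> borel_measurable M" "g \<in> borel_measurable M"
  shows "(\<lambda>\<omega>. lratio N v (f \<omega>) (g \<omega>)) \<in> borel_measurable M"
  unfolding lratio_def normal_density_def by measurable

lemma lratio_eq_exp:
  assumes "0 < N" "0 \<le> v"
  shows "lratio N v x y = sqrt (1 + v / N) * exp (y\<^sup>2 / (2 * (N + v)) - (y - x)\<^sup>2 / (2 * N))"
proof -
  have "sqrt (1 + v / N) = sqrt (N + v) / sqrt N"
    using assms by (simp add: real_sqrt_divide[symmetric] add_divide_distrib)
  moreover have "exp (y\<^sup>2 / (2 * (N + v)) - (y - x)\<^sup>2 / (2 * N))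
      = exp (- ((y - x)\<^sup>2) / (2 * N)) / exp (- (y\<^sup>2) / (2 * (N + v)))"
    by (simp add: exp_diff[symmetric])
  ultimately show ?thesis
    using assms by (simp add: lratio_def normal_density_def real_sqrt_mult del: distrib_left_numeral)
qed

lemma nn_integral_lratio:
  assumes "0 < N" "0 \<le> v"
  shows "(\<integral>\<^sup>+u. ennreal (lratio N (v + d\<^sup>2) (x + d * u) y) \<partial>std_normal) = ennreal (lratio (N + d\<^sup>2) v x y)"
proof -
  define c where "c = 1 / normal_density 0 (sqrt (N + (v + d\<^sup>2))) y"
  have c_nonneg: "0 \<le> c" by (simp add: c_def)
  have "(\<integral>\<^sup>+u. ennreal (lratio N (v + d\<^sup>2) (x + d * u) y) \<partial>std_normal)
      = (\<integral>\<^sup>+u. ennreal c * ennreal (normal_density (x + d * u) (sqrt N) y) \<partial>std_normal)"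
    using c_nonneg by (simp add: lratio_def c_def ennreal_mult[symmetric])
  also have "\<dots> = ennreal c * (\<integral>\<^sup>+u. ennreal (normal_density (x + d * u) (sqrt N) y) \<partial>std_normal)"
    by (intro nn_integral_cmult) (simp add: normal_density_def)
  also have "\<dots> = ennreal (lratio (N + d\<^sup>2) v x y)"
    using assms c_nonneg
    by (simp add: nn_integral_normal_density_mean ennreal_mult[symmetric] lratio_def c_def add_ac)
  finally show ?thesis .
qed

lemma nn_integral_lratio_eq_1:
  assumes "0 < N"
  shows "(\<integral>\<^sup>+u. ennreal (lratio N (d\<^sup>2) (d * u) y) \<partial>std_normal) = 1"
proof -
  have "0 < normal_density 0 (sqrt (N + d\<^sup>2)) y"
    using assms by (intro normal_density_pos) (simp add: add_pos_nonneg)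
  then show ?thesis
    using nn_integral_lratio[OF assms order_refl, of d 0 y] by (simp add: lratio_def)
qed

text \<open>Two received signals with uncorrelated inputs are independent, even though they are formed from
  the same two symbols.\<close>

lemma nn_integral_lratio_orthogonal:
  assumes "0 < N" "0 < N'"
  shows "(\<integral>\<^sup>+u. \<integral>\<^sup>+v. ennreal (lratio N (a\<^sup>2 + b\<^sup>2) (a * u + b * v) y *
      lratio N' (k\<^sup>2 * (a\<^sup>2 + b\<^sup>2)) (k * (a * v - b * u)) z) \<partial>std_normal \<partial>std_normal) = 1"
proof -
  define r where "r = sqrt (a\<^sup>2 + b\<^sup>2)"
  have r_square: "a\<^sup>2 + b\<^sup>2 = r\<^sup>2" by (simp add: r_def)
  have "(\<integral>\<^sup>+u. \<integral>\<^sup>+v. ennreal (lratio N (a\<^sup>2 + b\<^sup>2) (a * u + b * v) y *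
        lratio N' (k\<^sup>2 * (a\<^sup>2 + b\<^sup>2)) (k * (a * v - b * u)) z) \<partial>std_normal \<partial>std_normal)
      = (\<integral>\<^sup>+u. \<integral>\<^sup>+v. ennreal (lratio N (r\<^sup>2) (r * u) y * lratio N' (k\<^sup>2 * r\<^sup>2) (k * (r * v)) z)
        \<partial>std_normal \<partial>std_normal)"
    unfolding r_square
    by (rule nn_integral_std_normal_rotation[of
      "\<lambda>p q. ennreal (lratio N (r\<^sup>2) p y * lratio N' (k\<^sup>2 * r\<^sup>2) (k * q) z)" a b, folded r_def])
      (simp add: split_beta')
  also have "\<dots> = 1"
    using nn_integral_lratio_eq_1[OF assms(1), of r y] nn_integral_lratio_eq_1[OF assms(2), of "k * r" z]
    by (simp add: ennreal_mult lratio_nonneg nn_integral_cmult power_mult_distrib mult.assoc)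
  finally show ?thesis .
qed

section \<open>Product measures\<close>

lemma measurable_case_prod3_compose:
  assumes "(\<lambda>(a, b, c). f a b c) \<in> measurable (A \<Otimes>\<^sub>M B \<Otimes>\<^sub>M C) N"
    and "g \<in> measurable L A" "h \<in> measurable L B" "k \<in> measurable L C"
  shows "(\<lambda>x. f (g x) (h x) (k x)) \<in> measurable L N"
  using measurable_compose[OF measurable_Pair[OF assms(2) measurable_Pair[OF assms(3,4)]] assms(1)]
  by simp

lemma nn_integral_pair_measure3:
  assumes "sigma_finite_measure B" "sigma_finite_measure C"
    and f [measurable]: "(\<lambda>(a, b, c). f a b c) \<in> borel_measurable (A \<Otimes>\<^sub>M B \<Otimes>\<^sub>M C)"
  shows "(\<integral>\<^sup>+(a, b, c). f a b c \<partial>(A \<Otimes>\<^sub>M B \<Otimes>\<^sub>M C)) = (\<integral>\<^sup>+a. \<integral>\<^sup>+b. \<integral>\<^sup>+c. f a b c \<partial>C \<partial>B \<partial>A)"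
proof -
  interpret B: sigma_finite_measure B by fact
  interpret C: sigma_finite_measure C by fact
  interpret BC: pair_sigma_finite B C ..
  have "(\<integral>\<^sup>+(a, b, c). f a b c \<partial>(A \<Otimes>\<^sub>M B \<Otimes>\<^sub>M C)) = (\<integral>\<^sup>+a. \<integral>\<^sup>+(b, c). f a b c \<partial>(B \<Otimes>\<^sub>M C) \<partial>A)"
    using BC.P.nn_integral_fst[OF f] by simp
  also have "\<dots> = (\<integral>\<^sup>+a. \<integral>\<^sup>+b. \<integral>\<^sup>+c. f a b c \<partial>C \<partial>B \<partial>A)"
  proof (intro nn_integral_cong)
    fix a assume "a \<in> space A"
    then have "(\<lambda>(b, c). f a b c) \<in> borel_measurable (B \<Otimes>\<^sub>M C)"
      using measurable_compose[OF measurable_Pair1' f] by simp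
    then show "(\<integral>\<^sup>+(b, c). f a b c \<partial>(B \<Otimes>\<^sub>M C)) = (\<integral>\<^sup>+b. \<integral>\<^sup>+c. f a b c \<partial>C \<partial>B)"
      using C.nn_integral_fst[of "\<lambda>(b, c). f a b c"] by simp
  qed
  finally show ?thesis .
qed

lemma (in prob_space) nn_integral_less_imp_ex:
  assumes "(\<integral>\<^sup>+x. f x \<partial>M) < c"
  obtains x where "x \<in> space M" "f x < c"
proof -
  have "\<exists>x\<in>space M. f x < c"
  proof (rule ccontr)
    assume "\<not> ?thesis"
    then have "c \<le> (\<integral>\<^sup>+x. f x \<partial>M)" by (intro nn_integral_ge_const) (auto simp: not_less)
    then show False using assms by simp
  qed
  then show thesis using that by blast
qed

lemma (in finite_measure) measure_le_of_indicator_le: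
  assumes "\<And>x. x \<in> space M \<Longrightarrow> indicator S x \<le> f x" and "(\<integral>\<^sup>+x. f x \<partial>M) \<le> ennreal c" "0 \<le> c"
  shows "measure M S \<le> c"
proof (cases "S \<in> sets M")
  case True
  then have "emeasure M S = (\<integral>\<^sup>+x. indicator S x \<partial>M)" by simp
  also have "\<dots> \<le> (\<integral>\<^sup>+x. f x \<partial>M)" by (intro nn_integral_mono assms(1))
  also note assms(2)
  finally show ?thesis using assms(3) by (simp add: emeasure_eq_measure)
qed (simp add: measure_notin_sets assms(3))

lemma (in product_prob_space) nn_integral_PiM_resample:
  assumes index: "finite J" "i \<in> J" and [measurable]: "f \<in> borel_measurable (PiM J M)"
  shows "(\<integral>\<^sup>+x. f x \<partial>PiM J M) = (\<integral>\<^sup>+x. \<integral>\<^sup>+y. f (x(i := y)) \<partial>M i \<partial>PiM J M)"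
proof -
  have split: "(\<integral>\<^sup>+x. g x \<partial>PiM J M) = (\<integral>\<^sup>+x. \<integral>\<^sup>+y. g (x(i := y)) \<partial>M i \<partial>PiM (J - {i}) M)"
    if "g \<in> borel_measurable (PiM J M)" for g
    using product_nn_integral_insert[of "J - {i}" i g] that index by (simp add: insert_absorb)
  have [measurable]: "(\<lambda>p. (fst p)(i := snd p)) \<in> measurable (PiM J M \<Otimes>\<^sub>M M i) (PiM J M)"
    using index by (intro measurable_fun_upd[of J J]) auto
  have "(\<integral>\<^sup>+x. \<integral>\<^sup>+y. f (x(i := y)) \<partial>M i \<partial>PiM J M)
      = (\<integral>\<^sup>+x. \<integral>\<^sup>+z. \<integral>\<^sup>+y. f (x(i := z, i := y)) \<partial>M i \<partial>M i \<partial>PiM (J - {i}) M)"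
    by (rule split) measurable
  also have "\<dots> = (\<integral>\<^sup>+x. \<integral>\<^sup>+y. f (x(i := y)) \<partial>M i \<partial>PiM (J - {i}) M)"
    by (simp add: prob_space.emeasure_space_1[OF prob_space])
  also have "\<dots> = (\<integral>\<^sup>+x. f x \<partial>PiM J M)"
    by (rule split[symmetric]) measurable
  finally show ?thesis ..
qed

lemma (in product_prob_space) nn_integral_PiM_le_resample:
  assumes "finite J" "i \<in> J" "f \<in> borel_measurable (PiM J M)"
    and bound: "\<And>x. x \<in> space (PiM J M) \<Longrightarrow> (\<integral>\<^sup>+y. f (x(i := y)) \<partial>M i) \<le> c"
  shows "(\<integral>\<^sup>+x. f x \<partial>PiM J M) \<le> c"
proof -
  interpret J: prob_space "PiM J M" by (intro prob_space_PiM prob_space)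
  show ?thesis
    unfolding nn_integral_PiM_resample[OF assms(1-3)]
    by (rule J.nn_integral_le_const[OF zero_le AE_I2[OF bound]])
qed

lemma (in product_prob_space) nn_integral_PiM_resample2:
  assumes index: "finite J" "i \<in> J" "j \<in> J" and [measurable]: "f \<in> borel_measurable (PiM J M)"
  shows "(\<integral>\<^sup>+x. f x \<partial>PiM J M) = (\<integral>\<^sup>+x. \<integral>\<^sup>+y. \<integral>\<^sup>+z. f (x(i := y, j := z)) \<partial>M j \<partial>M i \<partial>PiM J M)"
proof -
  have [measurable]: "(\<lambda>p. (fst p)(j := snd p)) \<in> measurable (PiM J M \<Otimes>\<^sub>M M j) (PiM J M)"
    using index by (intro measurable_fun_upd[of J J]) auto
  have "(\<integral>\<^sup>+x. f x \<partial>PiM J M) = (\<integral>\<^sup>+x. \<integral>\<^sup>+z. f (x(j := z)) \<partial>M j \<partial>PiM J M)"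
    using index by (intro nn_integral_PiM_resample) auto
  also have "\<dots> = (\<integral>\<^sup>+x. \<integral>\<^sup>+y. \<integral>\<^sup>+z. f (x(i := y, j := z)) \<partial>M j \<partial>M i \<partial>PiM J M)"
    using index by (intro nn_integral_PiM_resample) measurable
  finally show ?thesis .
qed

lemma (in product_prob_space) nn_integral_PiM_component:
  assumes "finite J" "i \<in> J" and [measurable]: "f \<in> borel_measurable (M i)"
  shows "(\<integral>\<^sup>+x. f (x i) \<partial>PiM J M) = (\<integral>\<^sup>+y. f y \<partial>M i)"
proof -
  interpret J: prob_space "PiM J M" by (intro prob_space_PiM prob_space)
  show ?thesis
    using assms by (subst nn_integral_PiM_resample[of J i]) (auto simp: J.emeasure_space_1)
qed

lemma (in product_prob_space) nn_integral_PiM_pair_mult: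
  assumes index: "finite J" "i \<in> J" "j \<in> J" "i \<noteq> j"
    and [measurable]: "(\<lambda>(u, v). F u v) \<in> borel_measurable (M i \<Otimes>\<^sub>M M j)" "R \<in> borel_measurable (PiM J M)"
    and invariant: "\<And>x u v. R (x(i := u, j := v)) = R x"
  shows "(\<integral>\<^sup>+x. F (x i) (x j) * R x \<partial>PiM J M)
    = (\<integral>\<^sup>+u. \<integral>\<^sup>+v. F u v \<partial>M j \<partial>M i) * (\<integral>\<^sup>+x. R x \<partial>PiM J M)"
proof -
  interpret Mj: prob_space "M j" by (rule prob_space)
  note [measurable] = index(2,3)
  have "(\<integral>\<^sup>+x. F (x i) (x j) * R x \<partial>PiM J M)
      = (\<integral>\<^sup>+x. \<integral>\<^sup>+u. \<integral>\<^sup>+v. F u v * R x \<partial>M j \<partial>M i \<partial>PiM J M)"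
    by (subst nn_integral_PiM_resample2[OF index(1-3)], measurable)
      (simp only: invariant fun_upd_same fun_upd_other[OF index(4)])
  also have "\<dots> = (\<integral>\<^sup>+x. (\<integral>\<^sup>+u. \<integral>\<^sup>+v. F u v \<partial>M j \<partial>M i) * R x \<partial>PiM J M)"
    by (intro nn_integral_cong, subst nn_integral_multc[symmetric], measurable,
      intro nn_integral_cong nn_integral_multc) measurable
  also have "\<dots> = (\<integral>\<^sup>+u. \<integral>\<^sup>+v. F u v \<partial>M j \<partial>M i) * (\<integral>\<^sup>+x. R x \<partial>PiM J M)"
    by (intro nn_integral_cmult) measurable
  finally show ?thesis .
qed

lemma (in product_prob_space) nn_integral_PiM_prod_pairs:
  assumes "finite J" "inj_on p K" "inj_on q K" "p ` K \<inter> q ` K = {}" "p ` K \<union> q ` K \<subseteq> J"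
    and "\<And>k. k \<in> K \<Longrightarrow> (\<lambda>(u, v). F k u v) \<in> borel_measurable (M (p k) \<Otimes>\<^sub>M M (q k))"
  shows "(\<integral>\<^sup>+x. (\<Prod>k\<in>K. F k (x (p k)) (x (q k))) \<partial>PiM J M)
    = (\<Prod>k\<in>K. \<integral>\<^sup>+u. \<integral>\<^sup>+v. F k u v \<partial>M (q k) \<partial>M (p k))"
proof -
  have "finite K"
    using assms(1,2,5) by (meson finite_imageD finite_subset le_supE)
  then show ?thesis using assms(2-)
  proof (induction K)
    case empty
    interpret J: prob_space "PiM J M" by (intro prob_space_PiM prob_space)
    show ?case by (simp add: J.emeasure_space_1)
  next
    case (insert k K)
    let ?R = "\<lambda>x. \<Prod>l\<in>K. F l (x (p l)) (x (q l))"
    have disjoint: "p l \<noteq> q m" if "l \<in> insert k K" "m \<in> insert k K" for l m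
      using insert.prems(3) that by blast
    have distinct: "p l \<noteq> p k" "p l \<noteq> q k" "q l \<noteq> p k" "q l \<noteq> q k" if "l \<in> K" for l
      using that insert.hyps(2) disjoint[of k l] disjoint[of l k] inj_onD[OF insert.prems(1), of l k]
        inj_onD[OF insert.prems(2), of l k] by (auto dest: sym)
    have factor_measurable: "(\<lambda>x. F l (x (p l)) (x (q l))) \<in> borel_measurable (PiM J M)" if "l \<in> K" for l
    proof -
      have [measurable]: "p l \<in> J" "q l \<in> J" using insert.prems(4) that by auto
      have [measurable]: "(\<lambda>(u, v). F l u v) \<in> borel_measurable (M (p l) \<Otimes>\<^sub>M M (q l))"
        using that by (intro insert.prems(5)) simp
      show ?thesis by measurable
    qed
    have "(\<integral>\<^sup>+x. (\<Prod>l\<in>insert k K. F l (x (p l)) (x (q l))) \<partial>PiM J M)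
        = (\<integral>\<^sup>+x. F k (x (p k)) (x (q k)) * ?R x \<partial>PiM J M)"
      using insert.hyps by simp
    also have "\<dots> = (\<integral>\<^sup>+u. \<integral>\<^sup>+v. F k u v \<partial>M (q k) \<partial>M (p k)) * (\<integral>\<^sup>+x. ?R x \<partial>PiM J M)"
    proof (rule nn_integral_PiM_pair_mult)
      show "?R \<in> borel_measurable (PiM J M)"
        by (intro borel_measurable_prod_ennreal factor_measurable)
      show "?R (x(p k := u, q k := v)) = ?R x" for x u v
        using distinct by (intro prod.cong) simp_all
    qed (use assms(1) insert.prems(4,5) disjoint in auto)
    also have "(\<integral>\<^sup>+x. ?R x \<partial>PiM J M) = (\<Prod>l\<in>K. \<integral>\<^sup>+u. \<integral>\<^sup>+v. F l u v \<partial>M (q l) \<partial>M (p l))"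
      using insert.prems by (intro insert.IH) (auto simp: inj_on_insert)
    finally show ?case using insert.hyps by simp
  qed
qed

section \<open>Random coding for two transmitters\<close>

text \<open>A pair of codewords is accepted if its three scores are at least 1. The penalty dominates the
  rejection of the transmitted pair; its own mean is controlled along with the error probability
  because it will also bound the energy of the channel inputs.\<close>

locale mac_random_coding =
  A: prob_space A + B: prob_space B + W: prob_space W
  for A :: "'a measure" and B :: "'b measure" and W :: "'w measure" +
  fixes Y :: "'y measure" and out :: "'a \<Rightarrow> 'b \<Rightarrow> 'w \<Rightarrow> 'y"
    and score12 score1 score2 :: "'a \<Rightarrow> 'b \<Rightarrow> 'y \<Rightarrow> ennreal"
    and penalty :: "'a \<Rightarrow> 'b \<Rightarrow> 'w \<Rightarrow> ennreal"
    and \<epsilon>12 \<epsilon>1 \<epsilon>2 :: ennreal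
  assumes out_measurable: "(\<lambda>(a, b, w). out a b w) \<in> measurable (A \<Otimes>\<^sub>M B \<Otimes>\<^sub>M W) Y"
    and score12_measurable: "(\<lambda>(a, b, y). score12 a b y) \<in> borel_measurable (A \<Otimes>\<^sub>M B \<Otimes>\<^sub>M Y)"
    and score1_measurable: "(\<lambda>(a, b, y). score1 a b y) \<in> borel_measurable (A \<Otimes>\<^sub>M B \<Otimes>\<^sub>M Y)"
    and score2_measurable: "(\<lambda>(a, b, y). score2 a b y) \<in> borel_measurable (A \<Otimes>\<^sub>M B \<Otimes>\<^sub>M Y)"
    and penalty_measurable: "(\<lambda>(a, b, w). penalty a b w) \<in> borel_measurable (A \<Otimes>\<^sub>M B \<Otimes>\<^sub>M W)"
    and nn_integral_score12: "y \<in> space Y \<Longrightarrow> (\<integral>\<^sup>+a. \<integral>\<^sup>+b. score12 a b y \<partial>B \<partial>A) \<le> \<epsilon>12"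
    and nn_integral_score1: "b \<in> space B \<Longrightarrow> y \<in> space Y \<Longrightarrow> (\<integral>\<^sup>+a. score1 a b y \<partial>A) \<le> \<epsilon>1"
    and nn_integral_score2: "a \<in> space A \<Longrightarrow> y \<in> space Y \<Longrightarrow> (\<integral>\<^sup>+b. score2 a b y \<partial>B) \<le> \<epsilon>2"
    and one_le_penalty: "a \<in> space A \<Longrightarrow> b \<in> space B \<Longrightarrow> w \<in> space W \<Longrightarrow>
      score12 a b (out a b w) < 1 \<or> score1 a b (out a b w) < 1 \<or> score2 a b (out a b w) < 1 \<Longrightarrow>
      1 \<le> penalty a b w"
begin

lemmas out_compose [measurable] = measurable_case_prod3_compose[OF out_measurable]
lemmas score12_compose [measurable] = measurable_case_prod3_compose[OF score12_measurable]
lemmas score1_compose [measurable] = measurable_case_prod3_compose[OF score1_measurable]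
lemmas score2_compose [measurable] = measurable_case_prod3_compose[OF score2_measurable]
lemmas penalty_compose [measurable] = measurable_case_prod3_compose[OF penalty_measurable]

lemma out_space: "a \<in> space A \<Longrightarrow> b \<in> space B \<Longrightarrow> w \<in> space W \<Longrightarrow> out a b w \<in> space Y"
  using measurable_space[OF out_measurable, of "(a, b, w)"] by (simp add: space_pair_measure)

definition accept :: "'a \<Rightarrow> 'b \<Rightarrow> 'y \<Rightarrow> bool" where
  "accept a b y \<longleftrightarrow> 1 \<le> score12 a b y \<and> 1 \<le> score1 a b y \<and> 1 \<le> score2 a b y"

lemma accept_compose [measurable]:
  assumes [measurable]: "f \<in> measurable L A" "g \<in> measurable L B" "h \<in> measurable L Y"
  shows "Measurable.pred L (\<lambda>x. accept (f x) (g x) (h x))"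
  unfolding accept_def by measurable

definition decode :: "nat \<Rightarrow> nat \<Rightarrow> (nat \<Rightarrow> 'a) \<Rightarrow> (nat \<Rightarrow> 'b) \<Rightarrow> 'y \<Rightarrow> nat \<times> nat" where
  "decode M1 M2 c1 c2 y = prod_decode (LEAST j. fst (prod_decode j) < M1 \<and> snd (prod_decode j) < M2 \<and>
     accept (c1 (fst (prod_decode j))) (c2 (snd (prod_decode j))) y)"

lemma decode_measurable:
  assumes [measurable]: "\<And>m. c1 m \<in> space A" "\<And>m. c2 m \<in> space B"
  shows "decode M1 M2 c1 c2 \<in> measurable Y (count_space UNIV)"
  unfolding decode_def by measurable

lemma decode_eqI:
  assumes "m1 < M1" "m2 < M2" "accept (c1 m1) (c2 m2) y"
    and unique: "\<And>m1' m2'. m1' < M1 \<Longrightarrow> m2' < M2 \<Longrightarrow> accept (c1 m1') (c2 m2') y \<Longrightarrow> (m1', m2') = (m1, m2)"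
  shows "decode M1 M2 c1 c2 y = (m1, m2)"
proof -
  let ?accepted = "\<lambda>j. fst (prod_decode j) < M1 \<and> snd (prod_decode j) < M2 \<and>
    accept (c1 (fst (prod_decode j))) (c2 (snd (prod_decode j))) y"
  have "(LEAST j. ?accepted j) = prod_encode (m1, m2)"
  proof (rule Least_equality)
    show "?accepted (prod_encode (m1, m2))" using assms(1-3) by simp
    fix j assume "?accepted j"
    then have "prod_decode j = (m1, m2)" using unique by (metis prod.collapse)
    then show "prod_encode (m1, m2) \<le> j" by (metis prod_decode_inverse order_refl)
  qed
  then show ?thesis by (simp add: decode_def)
qed

definition union_bound :: "nat \<Rightarrow> nat \<Rightarrow> nat \<Rightarrow> nat \<Rightarrow> (nat \<Rightarrow> 'a) \<Rightarrow> (nat \<Rightarrow> 'b) \<Rightarrow> 'w \<Rightarrow> ennreal" where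
  "union_bound M1 M2 m1 m2 c1 c2 w = (let y = out (c1 m1) (c2 m2) w in
     2 * penalty (c1 m1) (c2 m2) w
     + (\<Sum>m1'\<in>{..<M1} - {m1}. score1 (c1 m1') (c2 m2) y)
     + (\<Sum>m2'\<in>{..<M2} - {m2}. score2 (c1 m1) (c2 m2') y)
     + (\<Sum>(m1', m2')\<in>({..<M1} - {m1}) \<times> ({..<M2} - {m2}). score12 (c1 m1') (c2 m2') y))"

lemma decode_cases [consumes 2]:
  assumes "m1 < M1" "m2 < M2"
  obtains (correct) "decode M1 M2 c1 c2 y = (m1, m2)"
    | (rejected) "\<not> accept (c1 m1) (c2 m2) y"
    | (user1) m1' where "m1' < M1" "m1' \<noteq> m1" "accept (c1 m1') (c2 m2) y"
    | (user2) m2' where "m2' < M2" "m2' \<noteq> m2" "accept (c1 m1) (c2 m2') y"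
    | (both) m1' m2' where "m1' < M1" "m2' < M2" "m1' \<noteq> m1" "m2' \<noteq> m2" "accept (c1 m1') (c2 m2') y"
proof -
  have "decode M1 M2 c1 c2 y = (m1, m2) \<or> \<not> accept (c1 m1) (c2 m2) y \<or>
    (\<exists>m1'<M1. \<exists>m2'<M2. (m1', m2') \<noteq> (m1, m2) \<and> accept (c1 m1') (c2 m2') y)"
    using decode_eqI[OF assms, of c1 c2 y] by auto
  then show thesis using that by blast
qed

lemma decode_error_add_penalty_le:
  assumes "c1 m1 \<in> space A" "c2 m2 \<in> space B" "w \<in> space W" and messages: "m1 < M1" "m2 < M2"
  shows "of_bool (decode M1 M2 c1 c2 (out (c1 m1) (c2 m2) w) \<noteq> (m1, m2)) + penalty (c1 m1) (c2 m2) w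
    \<le> union_bound M1 M2 m1 m2 c1 c2 w"
proof -
  define y where "y = out (c1 m1) (c2 m2) w"
  let ?S1 = "\<Sum>m1'\<in>{..<M1} - {m1}. score1 (c1 m1') (c2 m2) y"
  let ?S2 = "\<Sum>m2'\<in>{..<M2} - {m2}. score2 (c1 m1) (c2 m2') y"
  let ?S12 = "\<Sum>(m1', m2')\<in>({..<M1} - {m1}) \<times> ({..<M2} - {m2}). score12 (c1 m1') (c2 m2') y"
  have "of_bool (decode M1 M2 c1 c2 y \<noteq> (m1, m2)) \<le> penalty (c1 m1) (c2 m2) w + ?S1 + ?S2 + ?S12"
    using messages
  proof (cases rule: decode_cases[of m1 M1 m2 M2 c1 c2 y])
    case correct
    then show ?thesis by simp
  next
    case rejected
    then have "1 \<le> penalty (c1 m1) (c2 m2) w"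
      using one_le_penalty[OF assms(1-3)] by (auto simp: accept_def y_def not_le)
    then show ?thesis by (simp add: add_increasing2)
  next
    case (user1 m1')
    then have "1 \<le> score1 (c1 m1') (c2 m2) y" by (simp add: accept_def)
    also have "\<dots> \<le> ?S1" using user1 by (intro member_le_sum) auto
    finally show ?thesis by (simp add: add_increasing add_increasing2)
  next
    case (user2 m2')
    then have "1 \<le> score2 (c1 m1) (c2 m2') y" by (simp add: accept_def)
    also have "\<dots> \<le> ?S2" using user2 by (intro member_le_sum) auto
    finally show ?thesis by (simp add: add_increasing add_increasing2)
  next
    case (both m1' m2')
    then have "1 \<le> score12 (c1 m1') (c2 m2') y" by (simp add: accept_def)
    also have "\<dots> \<le> ?S12"
      using both member_le_sum[of "(m1', m2')" "({..<M1} - {m1}) \<times> ({..<M2} - {m2})"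
        "\<lambda>(i, j). score12 (c1 i) (c2 j) y"] by auto
    finally show ?thesis by (simp add: add_increasing)
  qed
  from add_right_mono[OF this, of "penalty (c1 m1) (c2 m2) w"] show ?thesis
    by (simp add: union_bound_def y_def Let_def mult_2 add_ac)
qed

abbreviation codebook1 :: "nat \<Rightarrow> (nat \<Rightarrow> 'a) measure" where
  "codebook1 M1 \<equiv> PiM {..<M1} (\<lambda>_. A)"

abbreviation codebook2 :: "nat \<Rightarrow> (nat \<Rightarrow> 'b) measure" where
  "codebook2 M2 \<equiv> PiM {..<M2} (\<lambda>_. B)"

lemma prob_space_codebooks: "prob_space (codebook1 M1)" "prob_space (codebook2 M2)"
  by (intro prob_space_PiM A.prob_space_axioms B.prob_space_axioms)+

lemma nn_integral_experiment:
  assumes "(\<lambda>(w, c1, c2). f w c1 c2) \<in> borel_measurable (W \<Otimes>\<^sub>M codebook1 M1 \<Otimes>\<^sub>M codebook2 M2)"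
  shows "(\<integral>\<^sup>+(w, c1, c2). f w c1 c2 \<partial>(W \<Otimes>\<^sub>M codebook1 M1 \<Otimes>\<^sub>M codebook2 M2))
    = (\<integral>\<^sup>+w. \<integral>\<^sup>+c1. \<integral>\<^sup>+c2. f w c1 c2 \<partial>codebook2 M2 \<partial>codebook1 M1 \<partial>W)"
proof -
  interpret C1: prob_space "codebook1 M1" by (rule prob_space_codebooks)
  interpret C2: prob_space "codebook2 M2" by (rule prob_space_codebooks)
  show ?thesis
    by (intro nn_integral_pair_measure3 assms C1.sigma_finite_measure_axioms
      C2.sigma_finite_measure_axioms)
qed

lemma experiment_measurable:
  assumes "m1 < M1" "m1' < M1" "m2 < M2" "m2' < M2"
  shows "(\<lambda>(w, c1, c2). penalty (c1 m1) (c2 m2) w)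
      \<in> borel_measurable (W \<Otimes>\<^sub>M codebook1 M1 \<Otimes>\<^sub>M codebook2 M2)"
    and "(\<lambda>(w, c1, c2). score1 (c1 m1') (c2 m2) (out (c1 m1) (c2 m2) w))
      \<in> borel_measurable (W \<Otimes>\<^sub>M codebook1 M1 \<Otimes>\<^sub>M codebook2 M2)"
    and "(\<lambda>(w, c1, c2). score2 (c1 m1) (c2 m2') (out (c1 m1) (c2 m2) w))
      \<in> borel_measurable (W \<Otimes>\<^sub>M codebook1 M1 \<Otimes>\<^sub>M codebook2 M2)"
    and "(\<lambda>(w, c1, c2). score12 (c1 m1') (c2 m2') (out (c1 m1) (c2 m2) w))
      \<in> borel_measurable (W \<Otimes>\<^sub>M codebook1 M1 \<Otimes>\<^sub>M codebook2 M2)"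
proof -
  have [measurable]: "m1 \<in> {..<M1}" "m1' \<in> {..<M1}" "m2 \<in> {..<M2}" "m2' \<in> {..<M2}"
    using assms by auto
  show "(\<lambda>(w, c1, c2). penalty (c1 m1) (c2 m2) w)
      \<in> borel_measurable (W \<Otimes>\<^sub>M codebook1 M1 \<Otimes>\<^sub>M codebook2 M2)"
    and "(\<lambda>(w, c1, c2). score1 (c1 m1') (c2 m2) (out (c1 m1) (c2 m2) w))
      \<in> borel_measurable (W \<Otimes>\<^sub>M codebook1 M1 \<Otimes>\<^sub>M codebook2 M2)"
    and "(\<lambda>(w, c1, c2). score2 (c1 m1) (c2 m2') (out (c1 m1) (c2 m2) w))
      \<in> borel_measurable (W \<Otimes>\<^sub>M codebook1 M1 \<Otimes>\<^sub>M codebook2 M2)"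
    and "(\<lambda>(w, c1, c2). score12 (c1 m1') (c2 m2') (out (c1 m1) (c2 m2) w))
      \<in> borel_measurable (W \<Otimes>\<^sub>M codebook1 M1 \<Otimes>\<^sub>M codebook2 M2)"
    by measurable
qed

lemma nn_integral_penalty_experiment:
  assumes messages: "m1 < M1" "m2 < M2"
  shows "(\<integral>\<^sup>+(w, c1, c2). penalty (c1 m1) (c2 m2) w \<partial>(W \<Otimes>\<^sub>M codebook1 M1 \<Otimes>\<^sub>M codebook2 M2))
    = (\<integral>\<^sup>+w. \<integral>\<^sup>+a. \<integral>\<^sup>+b. penalty a b w \<partial>B \<partial>A \<partial>W)"
proof -
  interpret PA: product_prob_space "\<lambda>_. A" UNIV ..
  interpret PB: product_prob_space "\<lambda>_. B" UNIV ..
  have "(\<integral>\<^sup>+c1. \<integral>\<^sup>+c2. penalty (c1 m1) (c2 m2) w \<partial>codebook2 M2 \<partial>codebook1 M1)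
      = (\<integral>\<^sup>+a. \<integral>\<^sup>+b. penalty a b w \<partial>B \<partial>A)" if [measurable]: "w \<in> space W" for w
  proof -
    have "(\<integral>\<^sup>+c1. \<integral>\<^sup>+c2. penalty (c1 m1) (c2 m2) w \<partial>codebook2 M2 \<partial>codebook1 M1)
        = (\<integral>\<^sup>+c1. \<integral>\<^sup>+b. penalty (c1 m1) b w \<partial>B \<partial>codebook1 M1)"
    proof (intro nn_integral_cong PB.nn_integral_PiM_component)
      fix c1 assume "c1 \<in> space (codebook1 M1)"
      then have [measurable]: "c1 m1 \<in> space A" using messages by (auto simp: space_PiM)
      show "(\<lambda>b. penalty (c1 m1) b w) \<in> borel_measurable B" by measurable
    qed (use messages in auto)
    also have "\<dots> = (\<integral>\<^sup>+a. \<integral>\<^sup>+b. penalty a b w \<partial>B \<partial>A)"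
      using messages by (intro PA.nn_integral_PiM_component) auto
    finally show ?thesis .
  qed
  then show ?thesis
    by (subst nn_integral_experiment[OF experiment_measurable(1)[OF messages(1,1) messages(2,2)]])
      (intro nn_integral_cong)
qed

text \<open>The codeword of a wrong message can be resampled without affecting the output.\<close>

lemma nn_integral_score1_experiment_le:
  assumes messages: "m1 < M1" "m2 < M2" "m1' < M1" "m1' \<noteq> m1"
  shows "(\<integral>\<^sup>+(w, c1, c2). score1 (c1 m1') (c2 m2) (out (c1 m1) (c2 m2) w)
    \<partial>(W \<Otimes>\<^sub>M codebook1 M1 \<Otimes>\<^sub>M codebook2 M2)) \<le> \<epsilon>1"
proof -
  interpret PA: product_prob_space "\<lambda>_. A" UNIV ..
  interpret C1: prob_space "codebook1 M1" by (rule prob_space_codebooks)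
  interpret C2: prob_space "codebook2 M2" by (rule prob_space_codebooks)
  interpret C: pair_prob_space "codebook1 M1" "codebook2 M2" ..
  have [measurable]: "m1 \<in> {..<M1}" "m1' \<in> {..<M1}" "m2 \<in> {..<M2}" using messages by auto
  let ?f = "\<lambda>w c1 c2. score1 (c1 m1') (c2 m2) (out (c1 m1) (c2 m2) w)"
  have "(\<integral>\<^sup>+c1. \<integral>\<^sup>+c2. ?f w c1 c2 \<partial>codebook2 M2 \<partial>codebook1 M1) \<le> \<epsilon>1"
    if w [measurable]: "w \<in> space W" for w
  proof -
    have "(\<integral>\<^sup>+c1. \<integral>\<^sup>+c2. ?f w c1 c2 \<partial>codebook2 M2 \<partial>codebook1 M1)
        = (\<integral>\<^sup>+c2. \<integral>\<^sup>+c1. ?f w c1 c2 \<partial>codebook1 M1 \<partial>codebook2 M2)"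
      by (intro C.Fubini'[symmetric]) measurable
    also have "\<dots> \<le> \<epsilon>1"
    proof (rule C2.nn_integral_le_const[OF zero_le AE_I2])
      fix c2 assume "c2 \<in> space (codebook2 M2)"
      then have c2 [measurable]: "c2 m2 \<in> space B" using messages by (auto simp: space_PiM)
      show "(\<integral>\<^sup>+c1. ?f w c1 c2 \<partial>codebook1 M1) \<le> \<epsilon>1"
      proof (rule PA.nn_integral_PiM_le_resample)
        fix c1 assume "c1 \<in> space (codebook1 M1)"
        then have "c1 m1 \<in> space A" using messages by (auto simp: space_PiM)
        then show "(\<integral>\<^sup>+a. ?f w (c1(m1' := a)) c2 \<partial>A) \<le> \<epsilon>1"
          using messages c2 w by (simp add: nn_integral_score1 out_space)
      qed (use messages in measurable)
    qed
    finally show ?thesis .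
  qed
  then show ?thesis
    by (subst nn_integral_experiment[OF experiment_measurable(2)[OF messages(1,3) messages(2,2)]])
      (rule W.nn_integral_le_const[OF zero_le AE_I2])
qed

lemma nn_integral_score2_experiment_le:
  assumes messages: "m1 < M1" "m2 < M2" "m2' < M2" "m2' \<noteq> m2"
  shows "(\<integral>\<^sup>+(w, c1, c2). score2 (c1 m1) (c2 m2') (out (c1 m1) (c2 m2) w)
    \<partial>(W \<Otimes>\<^sub>M codebook1 M1 \<Otimes>\<^sub>M codebook2 M2)) \<le> \<epsilon>2"
proof -
  interpret PB: product_prob_space "\<lambda>_. B" UNIV ..
  interpret C1: prob_space "codebook1 M1" by (rule prob_space_codebooks)
  have [measurable]: "m1 \<in> {..<M1}" "m2 \<in> {..<M2}" "m2' \<in> {..<M2}" using messages by auto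
  let ?f = "\<lambda>w c1 c2. score2 (c1 m1) (c2 m2') (out (c1 m1) (c2 m2) w)"
  have "(\<integral>\<^sup>+c1. \<integral>\<^sup>+c2. ?f w c1 c2 \<partial>codebook2 M2 \<partial>codebook1 M1) \<le> \<epsilon>2"
    if w [measurable]: "w \<in> space W" for w
  proof (rule C1.nn_integral_le_const[OF zero_le AE_I2])
    fix c1 assume "c1 \<in> space (codebook1 M1)"
    then have c1 [measurable]: "c1 m1 \<in> space A" using messages by (auto simp: space_PiM)
    show "(\<integral>\<^sup>+c2. ?f w c1 c2 \<partial>codebook2 M2) \<le> \<epsilon>2"
    proof (rule PB.nn_integral_PiM_le_resample)
      fix c2 assume "c2 \<in> space (codebook2 M2)"
      then have "c2 m2 \<in> space B" using messages by (auto simp: space_PiM)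
      then show "(\<integral>\<^sup>+b. ?f w c1 (c2(m2' := b)) \<partial>B) \<le> \<epsilon>2"
        using messages c1 w by (simp add: nn_integral_score2 out_space)
    qed (use messages in measurable)
  qed
  then show ?thesis
    by (subst nn_integral_experiment[OF experiment_measurable(3)[OF messages(1,1) messages(2,3)]])
      (rule W.nn_integral_le_const[OF zero_le AE_I2])
qed

lemma nn_integral_score12_experiment_le:
  assumes messages: "m1 < M1" "m2 < M2" "m1' < M1" "m2' < M2" "m1' \<noteq> m1" "m2' \<noteq> m2"
  shows "(\<integral>\<^sup>+(w, c1, c2). score12 (c1 m1') (c2 m2') (out (c1 m1) (c2 m2) w)
    \<partial>(W \<Otimes>\<^sub>M codebook1 M1 \<Otimes>\<^sub>M codebook2 M2)) \<le> \<epsilon>12"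
proof -
  interpret PA: product_prob_space "\<lambda>_. A" UNIV ..
  interpret PB: product_prob_space "\<lambda>_. B" UNIV ..
  interpret C2: prob_space "codebook2 M2" by (rule prob_space_codebooks)
  interpret AC2: pair_prob_space A "codebook2 M2" ..
  interpret AB: pair_prob_space A B ..
  have [measurable]: "m1 \<in> {..<M1}" "m1' \<in> {..<M1}" "m2 \<in> {..<M2}" "m2' \<in> {..<M2}" using messages by auto
  let ?f = "\<lambda>w c1 c2. score12 (c1 m1') (c2 m2') (out (c1 m1) (c2 m2) w)"
  have "(\<integral>\<^sup>+c1. \<integral>\<^sup>+c2. ?f w c1 c2 \<partial>codebook2 M2 \<partial>codebook1 M1) \<le> \<epsilon>12"
    if w [measurable]: "w \<in> space W" for w
  proof (rule PA.nn_integral_PiM_le_resample)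
    fix c1 assume "c1 \<in> space (codebook1 M1)"
    then have c1 [measurable]: "c1 m1 \<in> space A" using messages by (auto simp: space_PiM)
    have "(\<integral>\<^sup>+a. \<integral>\<^sup>+c2. ?f w (c1(m1' := a)) c2 \<partial>codebook2 M2 \<partial>A)
        = (\<integral>\<^sup>+c2. \<integral>\<^sup>+a. score12 a (c2 m2') (out (c1 m1) (c2 m2) w) \<partial>A \<partial>codebook2 M2)"
      using messages by (simp, intro AC2.Fubini'[symmetric]) measurable
    also have "\<dots> \<le> \<epsilon>12"
    proof (rule PB.nn_integral_PiM_le_resample)
      fix c2 assume "c2 \<in> space (codebook2 M2)"
      then have c2 [measurable]: "c2 m2 \<in> space B" using messages by (auto simp: space_PiM)
      have [measurable]: "out (c1 m1) (c2 m2) w \<in> space Y" using c1 c2 w by (rule out_space)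
      have "(\<integral>\<^sup>+b. \<integral>\<^sup>+a. score12 a b (out (c1 m1) (c2 m2) w) \<partial>A \<partial>B)
          = (\<integral>\<^sup>+a. \<integral>\<^sup>+b. score12 a b (out (c1 m1) (c2 m2) w) \<partial>B \<partial>A)"
        by (intro AB.Fubini') measurable
      also have "\<dots> \<le> \<epsilon>12" using c1 c2 w by (intro nn_integral_score12 out_space)
      finally show "(\<integral>\<^sup>+b. \<integral>\<^sup>+a. score12 a ((c2(m2' := b)) m2')
          (out (c1 m1) ((c2(m2' := b)) m2) w) \<partial>A \<partial>B) \<le> \<epsilon>12"
        using messages by simp
    qed (use messages in measurable)
    finally show "(\<integral>\<^sup>+a. \<integral>\<^sup>+c2. ?f w (c1(m1' := a)) c2 \<partial>codebook2 M2 \<partial>A) \<le> \<epsilon>12" .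
  qed (use messages in measurable)
  then show ?thesis
    by (subst nn_integral_experiment[OF experiment_measurable(4)[OF messages(1,3) messages(2,4)]])
      (rule W.nn_integral_le_const[OF zero_le AE_I2])
qed

definition mean_error_bound :: "nat \<Rightarrow> nat \<Rightarrow> ennreal \<Rightarrow> ennreal" where
  "mean_error_bound M1 M2 Q = 2 * Q + of_nat M1 * \<epsilon>1 + of_nat M2 * \<epsilon>2 + of_nat (M1 * M2) * \<epsilon>12"

lemma union_bound_experiment:
  assumes messages: "m1 < M1" "m2 < M2" and penalty_le: "(\<integral>\<^sup>+w. \<integral>\<^sup>+a. \<integral>\<^sup>+b. penalty a b w \<partial>B \<partial>A \<partial>W) \<le> Q"
  shows "(\<lambda>(w, c1, c2). union_bound M1 M2 m1 m2 c1 c2 w)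
      \<in> borel_measurable (W \<Otimes>\<^sub>M codebook1 M1 \<Otimes>\<^sub>M codebook2 M2)"
    and "(\<integral>\<^sup>+(w, c1, c2). union_bound M1 M2 m1 m2 c1 c2 w \<partial>(W \<Otimes>\<^sub>M codebook1 M1 \<Otimes>\<^sub>M codebook2 M2))
      \<le> mean_error_bound M1 M2 Q"
proof -
  let ?E = "W \<Otimes>\<^sub>M codebook1 M1 \<Otimes>\<^sub>M codebook2 M2"
  let ?I = "{..<M1} - {m1}" and ?J = "{..<M2} - {m2}"
  define p where "p = (\<lambda>(w, c1, c2). penalty (c1 m1) (c2 m2) w)"
  define s1 where "s1 i = (\<lambda>(w, c1, c2). score1 (c1 i) (c2 m2) (out (c1 m1) (c2 m2) w))" for i
  define s2 where "s2 j = (\<lambda>(w, c1, c2). score2 (c1 m1) (c2 j) (out (c1 m1) (c2 m2) w))" for j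
  define s12 where "s12 = (\<lambda>(i, j) (w, c1, c2). score12 (c1 i) (c2 j) (out (c1 m1) (c2 m2) w))"
  have terms_measurable: "p \<in> borel_measurable ?E" "i \<in> ?I \<Longrightarrow> s1 i \<in> borel_measurable ?E"
    "j \<in> ?J \<Longrightarrow> s2 j \<in> borel_measurable ?E" "k \<in> ?I \<times> ?J \<Longrightarrow> s12 k \<in> borel_measurable ?E" for i j k
    using experiment_measurable[OF messages(1) _ messages(2)] messages
    by (auto simp: p_def s1_def s2_def s12_def)
  have bounds: "(\<integral>\<^sup>+x. p x \<partial>?E) \<le> Q" "i \<in> ?I \<Longrightarrow> (\<integral>\<^sup>+x. s1 i x \<partial>?E) \<le> \<epsilon>1"
    "j \<in> ?J \<Longrightarrow> (\<integral>\<^sup>+x. s2 j x \<partial>?E) \<le> \<epsilon>2" for i j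
    using nn_integral_penalty_experiment[OF messages] penalty_le nn_integral_score1_experiment_le[OF messages, of i]
      nn_integral_score2_experiment_le[OF messages, of j] by (simp_all add: p_def s1_def s2_def)
  have bound12: "(\<integral>\<^sup>+x. s12 k x \<partial>?E) \<le> \<epsilon>12" if "k \<in> ?I \<times> ?J" for k
    using that nn_integral_score12_experiment_le[OF messages, of "fst k" "snd k"]
    by (simp add: s12_def mem_Times_iff split_beta')
  have union: "(\<lambda>(w, c1, c2). union_bound M1 M2 m1 m2 c1 c2 w)
      = (\<lambda>x. 2 * p x + (\<Sum>i\<in>?I. s1 i x) + (\<Sum>j\<in>?J. s2 j x) + (\<Sum>k\<in>?I \<times> ?J. s12 k x))"
    by (auto simp: union_bound_def p_def s1_def s2_def s12_def Let_def split_beta')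
  show "(\<lambda>(w, c1, c2). union_bound M1 M2 m1 m2 c1 c2 w) \<in> borel_measurable ?E"
    unfolding union
    by (intro borel_measurable_add borel_measurable_times_ennreal borel_measurable_const
      borel_measurable_sum terms_measurable)
  have "(\<integral>\<^sup>+x. 2 * p x + (\<Sum>i\<in>?I. s1 i x) + (\<Sum>j\<in>?J. s2 j x) + (\<Sum>k\<in>?I \<times> ?J. s12 k x) \<partial>?E)
      = 2 * (\<integral>\<^sup>+x. p x \<partial>?E) + (\<Sum>i\<in>?I. \<integral>\<^sup>+x. s1 i x \<partial>?E) + (\<Sum>j\<in>?J. \<integral>\<^sup>+x. s2 j x \<partial>?E)
        + (\<Sum>k\<in>?I \<times> ?J. \<integral>\<^sup>+x. s12 k x \<partial>?E)"
    using nn_integral_sum[of ?I s1 ?E] nn_integral_sum[of ?J s2 ?E] nn_integral_sum[of "?I \<times> ?J" s12 ?E]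
    by (simp only: nn_integral_add nn_integral_cmult borel_measurable_times_ennreal borel_measurable_const
      borel_measurable_add borel_measurable_sum terms_measurable)
  also have "\<dots> \<le> 2 * Q + (\<Sum>i\<in>?I. \<epsilon>1) + (\<Sum>j\<in>?J. \<epsilon>2) + (\<Sum>k\<in>?I \<times> ?J. \<epsilon>12)"
    by (intro add_mono mult_left_mono sum_mono bounds bound12 zero_le)
  also have "\<dots> \<le> mean_error_bound M1 M2 Q"
    unfolding mean_error_bound_def sum_constant
    using messages
    by (intro add_mono order_refl mult_right_mono) (auto simp: card_cartesian_product mult_mono)
  finally show "(\<integral>\<^sup>+(w, c1, c2). union_bound M1 M2 m1 m2 c1 c2 w \<partial>?E) \<le> mean_error_bound M1 M2 Q"
    by (simp only: union)
qed

lemma exists_codebooks_union_bound: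
  assumes penalty_le: "(\<integral>\<^sup>+w. \<integral>\<^sup>+a. \<integral>\<^sup>+b. penalty a b w \<partial>B \<partial>A \<partial>W) \<le> Q" and nonempty: "1 \<le> M1" "1 \<le> M2"
    and bound_less: "mean_error_bound M1 M2 Q < D"
  obtains c1 c2 where "c1 \<in> space (codebook1 M1)" "c2 \<in> space (codebook2 M2)"
    "(\<Sum>m\<in>{..<M1} \<times> {..<M2}. \<integral>\<^sup>+w. union_bound M1 M2 (fst m) (snd m) c1 c2 w \<partial>W) < of_nat (M1 * M2) * D"
proof -
  interpret C1: prob_space "codebook1 M1" by (rule prob_space_codebooks)
  interpret C2: prob_space "codebook2 M2" by (rule prob_space_codebooks)
  interpret C: pair_prob_space "codebook1 M1" "codebook2 M2" ..
  interpret WC: pair_prob_space W "codebook1 M1 \<Otimes>\<^sub>M codebook2 M2" ..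
  let ?E = "W \<Otimes>\<^sub>M codebook1 M1 \<Otimes>\<^sub>M codebook2 M2" and ?M = "{..<M1} \<times> {..<M2}"
  define loss where "loss m = (\<lambda>(w, c1, c2). union_bound M1 M2 (fst m) (snd m) c1 c2 w)" for m
  have loss: "loss m \<in> borel_measurable ?E" "(\<integral>\<^sup>+x. loss m x \<partial>?E) \<le> mean_error_bound M1 M2 Q"
    if "m \<in> ?M" for m
    using that union_bound_experiment[OF _ _ penalty_le, of "fst m" M1 "snd m" M2]
    by (auto simp: loss_def)
  have "(\<integral>\<^sup>+x. (\<Sum>m\<in>?M. loss m x) \<partial>?E) = (\<Sum>m\<in>?M. \<integral>\<^sup>+x. loss m x \<partial>?E)"
    by (intro nn_integral_sum loss)
  also have "\<dots> \<le> (\<Sum>m\<in>?M. mean_error_bound M1 M2 Q)"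
    by (intro sum_mono loss)
  also have "\<dots> = of_nat (M1 * M2) * mean_error_bound M1 M2 Q"
    by (simp add: card_cartesian_product)
  also have "\<dots> < of_nat (M1 * M2) * D"
    using nonempty bound_less
    by (intro ennreal_mult_strict_left_mono) (auto simp: ennreal_of_nat_eq_real_of_nat)
  finally have "(\<integral>\<^sup>+c. \<integral>\<^sup>+w. (\<Sum>m\<in>?M. loss m (w, c)) \<partial>W \<partial>(codebook1 M1 \<Otimes>\<^sub>M codebook2 M2))
      < of_nat (M1 * M2) * D"
    by (subst WC.nn_integral_snd) (auto intro!: borel_measurable_sum loss(1))
  then obtain c where c_space: "c \<in> space (codebook1 M1 \<Otimes>\<^sub>M codebook2 M2)"
    and small: "(\<integral>\<^sup>+w. (\<Sum>m\<in>?M. loss m (w, c)) \<partial>W) < of_nat (M1 * M2) * D"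
    by (rule C.nn_integral_less_imp_ex)
  have "(\<integral>\<^sup>+w. (\<Sum>m\<in>?M. loss m (w, c)) \<partial>W) = (\<Sum>m\<in>?M. \<integral>\<^sup>+w. loss m (w, c) \<partial>W)"
    by (intro nn_integral_sum measurable_compose[OF measurable_Pair2'[OF c_space] loss(1)])
  with small c_space show thesis
    by (intro that[of "fst c" "snd c"]) (auto simp: loss_def space_pair_measure split_beta')
qed

lemma exists_codebooks:
  assumes penalty_le: "(\<integral>\<^sup>+w. \<integral>\<^sup>+a. \<integral>\<^sup>+b. penalty a b w \<partial>B \<partial>A \<partial>W) \<le> Q" and nonempty: "1 \<le> M1" "1 \<le> M2"
    and bound_less: "mean_error_bound M1 M2 Q < D"
  obtains c1 c2 where "\<And>m. c1 m \<in> space A" "\<And>m. c2 m \<in> space B"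
    "(\<Sum>m\<in>{..<M1} \<times> {..<M2}. \<integral>\<^sup>+w. of_bool (decode M1 M2 c1 c2 (out (c1 (fst m)) (c2 (snd m)) w) \<noteq> m)
        + penalty (c1 (fst m)) (c2 (snd m)) w \<partial>W) \<le> of_nat (M1 * M2) * D"
proof -
  let ?M = "{..<M1} \<times> {..<M2}"
  obtain b1 b2 where b_space: "b1 \<in> space (codebook1 M1)" "b2 \<in> space (codebook2 M2)"
    and small: "(\<Sum>m\<in>?M. \<integral>\<^sup>+w. union_bound M1 M2 (fst m) (snd m) b1 b2 w \<partial>W) < of_nat (M1 * M2) * D"
    using exists_codebooks_union_bound[OF assms] by blast
  \<comment> \<open>Outside the index set \<open>b1\<close> and \<open>b2\<close> are undefined, so their values need not be codewords.\<close>
  define c1 where "c1 m = b1 (if m < M1 then m else 0)" for m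
  define c2 where "c2 m = b2 (if m < M2 then m else 0)" for m
  have c_space: "c1 m \<in> space A" "c2 m \<in> space B" for m
    using b_space nonempty by (auto simp: c1_def c2_def space_PiM)
  have "(\<Sum>m\<in>?M. \<integral>\<^sup>+w. of_bool (decode M1 M2 c1 c2 (out (c1 (fst m)) (c2 (snd m)) w) \<noteq> m)
        + penalty (c1 (fst m)) (c2 (snd m)) w \<partial>W)
      \<le> (\<Sum>m\<in>?M. \<integral>\<^sup>+w. union_bound M1 M2 (fst m) (snd m) b1 b2 w \<partial>W)"
  proof (intro sum_mono nn_integral_mono)
    fix m w assume m_in: "m \<in> ?M" and w: "w \<in> space W"
    have "union_bound M1 M2 (fst m) (snd m) c1 c2 w = union_bound M1 M2 (fst m) (snd m) b1 b2 w"
      using m_in by (auto simp: union_bound_def c1_def c2_def Let_def split_beta'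
        intro!: arg_cong2[where f = "(+)"] sum.cong)
    then show "of_bool (decode M1 M2 c1 c2 (out (c1 (fst m)) (c2 (snd m)) w) \<noteq> m)
        + penalty (c1 (fst m)) (c2 (snd m)) w \<le> union_bound M1 M2 (fst m) (snd m) b1 b2 w"
      using m_in decode_error_add_penalty_le[of c1 "fst m" c2 "snd m" w M1 M2] c_space w
      by (simp add: mem_Times_iff)
  qed
  then show thesis using small c_space by (intro that[of c1 c2]) auto
qed

end

section \<open>Blocks of normal variables\<close>

lemma prob_space_noise_space: "prob_space (noise_space n)"
  unfolding noise_space_def by (intro prob_space_PiM prob_space_std_normal)

lemma noise_space_component: "i < n \<Longrightarrow> (\<lambda>x. x i) \<in> borel_measurable (noise_space n)"
  unfolding noise_space_def
  using measurable_component_singleton[of i "{..<n}" "\<lambda>_. std_normal"] by simp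

lemma nn_integral_noise_space_prod_pairs:
  fixes F :: "nat \<Rightarrow> real \<Rightarrow> real \<Rightarrow> ennreal"
  assumes F_measurable: "\<And>k. k < K \<Longrightarrow> (\<lambda>(u, v). F k u v) \<in> borel_measurable (borel \<Otimes>\<^sub>M borel)"
    and slots: "2 * K \<le> n"
  shows "(\<integral>\<^sup>+x. (\<Prod>k<K. F k (x k) (x (K + k))) \<partial>noise_space n)
    = (\<Prod>k<K. \<integral>\<^sup>+u. \<integral>\<^sup>+v. F k u v \<partial>std_normal \<partial>std_normal)"
proof -
  interpret prob_space std_normal by (rule prob_space_std_normal)
  interpret product_prob_space "\<lambda>_::nat. std_normal" UNIV ..
  show ?thesis
    unfolding noise_space_def
    by (rule nn_integral_PiM_prod_pairs[where p = "\<lambda>k. k"])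
      (use slots F_measurable in \<open>auto simp: inj_on_def cong: measurable_cong_sets sets_pair_measure_cong\<close>)
qed

lemma nn_integral_noise_space_prod_gauss_mean:
  assumes [measurable]: "h \<in> borel_measurable borel" and "0 \<le> v" and slots: "2 * K \<le> n"
  shows "(\<integral>\<^sup>+x. (\<Prod>k<K. gauss_mean h v (y k + c * x k + d * x (K + k))) \<partial>noise_space n)
    = (\<Prod>k<K. gauss_mean h (v + (c\<^sup>2 + d\<^sup>2)) (y k))"
proof -
  have "(\<integral>\<^sup>+x. (\<Prod>k<K. gauss_mean h v (y k + c * x k + d * x (K + k))) \<partial>noise_space n)
      = (\<Prod>k<K. \<integral>\<^sup>+u. \<integral>\<^sup>+w. gauss_mean h v (y k + c * u + d * w) \<partial>std_normal \<partial>std_normal)"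
    by (rule nn_integral_noise_space_prod_pairs[OF _ slots]) (simp add: split_beta')
  also have "\<dots> = (\<Prod>k<K. gauss_mean h (v + (c\<^sup>2 + d\<^sup>2)) (y k))"
    using \<open>0 \<le> v\<close> by (simp add: nn_integral_gauss_mean) (simp add: add_ac)
  finally show ?thesis .
qed

text \<open>The seven normal variables of the block \<open>k\<close>: \<open>a\<close> and \<open>b\<close> are the codewords of the two users,
  \<open>fst w\<close> is the channel noise and \<open>snd w\<close> the feedback noise. The feedback of the second slot is
  never used.\<close>

type_synonym signal = "nat \<Rightarrow> real"
type_synonym block = "real \<times> real \<times> real \<times> real \<times> real \<times> real \<times> real"

definition block_at :: "nat \<Rightarrow> signal \<Rightarrow> signal \<Rightarrow> signal \<times> signal \<Rightarrow> nat \<Rightarrow> block" where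
  "block_at K a b w k = (a k, a (K + k), b k, b (K + k), fst w k, fst w (K + k), snd w k)"

definition energy :: "nat \<Rightarrow> block \<Rightarrow> signal \<Rightarrow> signal \<Rightarrow> signal \<times> signal \<Rightarrow> real" where
  "energy K c a b w = (\<Sum>k<K. (c \<bullet> block_at K a b w k)\<^sup>2)"

lemma block_at_measurable:
  assumes "k < K" "2 * K \<le> n"
    and [measurable]: "f \<in> measurable L (noise_space n)" "g \<in> measurable L (noise_space n)"
      "h \<in> measurable L (noise_space n \<Otimes>\<^sub>M noise_space n)"
  shows "(\<lambda>x. block_at K (f x) (g x) (h x) k) \<in> borel_measurable L"
proof -
  have "k < n" "K + k < n" using assms(1,2) by auto
  note [measurable] = this[THEN noise_space_component]
  show ?thesis unfolding block_at_def by measurable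
qed

lemma energy_measurable:
  assumes "2 * K \<le> n" "f \<in> measurable L (noise_space n)" "g \<in> measurable L (noise_space n)"
    "h \<in> measurable L (noise_space n \<Otimes>\<^sub>M noise_space n)"
  shows "(\<lambda>x. energy K c (f x) (g x) (h x)) \<in> borel_measurable L"
  unfolding energy_def
  by (intro borel_measurable_sum borel_measurable_power borel_measurable_inner
    borel_measurable_const block_at_measurable[OF _ assms]) simp

lemma nn_integral_prod_block_form:
  assumes h [measurable]: "h \<in> borel_measurable borel" and slots: "2 * K \<le> n"
  shows "(\<integral>\<^sup>+w. \<integral>\<^sup>+a. \<integral>\<^sup>+b. (\<Prod>k<K. h (c \<bullet> block_at K a b w k))
      \<partial>noise_space n \<partial>noise_space n \<partial>(noise_space n \<Otimes>\<^sub>M noise_space n))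
    = gauss_mean h (c \<bullet> c) 0 ^ K"
proof -
  interpret noise: prob_space "noise_space n" by (rule prob_space_noise_space)
  interpret noises: pair_prob_space "noise_space n" "noise_space n" ..
  note mean = nn_integral_noise_space_prod_gauss_mean[OF h _ slots]
  obtain c0 c1 c2 c3 c4 c5 c6 where c: "c = (c0, c1, c2, c3, c4, c5, c6)" by (cases c)
  have "(\<integral>\<^sup>+w. \<integral>\<^sup>+a. \<integral>\<^sup>+b. (\<Prod>k<K. h (c \<bullet> block_at K a b w k))
        \<partial>noise_space n \<partial>noise_space n \<partial>(noise_space n \<Otimes>\<^sub>M noise_space n))
      = (\<integral>\<^sup>+g. \<integral>\<^sup>+h'. \<integral>\<^sup>+a. \<integral>\<^sup>+b. (\<Prod>k<K. h (c \<bullet> block_at K a b (g, h') k))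
        \<partial>noise_space n \<partial>noise_space n \<partial>noise_space n \<partial>noise_space n)"
    by (subst noise.nn_integral_fst[symmetric])
      (auto intro!: noise.borel_measurable_nn_integral borel_measurable_prod_ennreal
        measurable_compose[OF _ h] borel_measurable_inner block_at_measurable[OF _ slots] simp: split_beta')
  \<comment> \<open>The summands 0 bring the form into the shape of \<open>mean\<close>.\<close>
  also have "\<dots> = (\<integral>\<^sup>+g. \<integral>\<^sup>+h'. \<integral>\<^sup>+a. \<integral>\<^sup>+b. (\<Prod>k<K. gauss_mean h 0
      (0 + c4 * g k + c5 * g (K + k) + c6 * h' k + 0 * h' (K + k) + c0 * a k + c1 * a (K + k)
        + c2 * b k + c3 * b (K + k))) \<partial>noise_space n \<partial>noise_space n \<partial>noise_space n \<partial>noise_space n)"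
    by (simp add: c block_at_def gauss_mean_0 add_ac)
  also have "\<dots> = (\<Prod>k<K. gauss_mean h (0 + (c2\<^sup>2 + c3\<^sup>2) + (c0\<^sup>2 + c1\<^sup>2) + (c6\<^sup>2 + 0\<^sup>2) + (c4\<^sup>2 + c5\<^sup>2)) 0)"
    by (subst mean, simp)+ simp
  also have "\<dots> = gauss_mean h (c \<bullet> c) 0 ^ K"
    by (simp add: c power2_eq_square add_ac)
  finally show ?thesis .
qed

definition chernoff_rate :: "real \<Rightarrow> real \<Rightarrow> real" where
  "chernoff_rate u x = exp (- u * x) / sqrt (1 - 2 * u)"

definition chernoff :: "real \<Rightarrow> real \<Rightarrow> nat \<Rightarrow> block \<Rightarrow> signal \<Rightarrow> signal \<Rightarrow> signal \<times> signal \<Rightarrow> real" where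
  "chernoff u x K c a b w = exp (u * (energy K c a b w / (c \<bullet> c) - real K * x))"

lemma nn_integral_chernoff:
  assumes "2 * u < 1" and "c \<noteq> 0" and slots: "2 * K \<le> n"
  shows "(\<integral>\<^sup>+w. \<integral>\<^sup>+a. \<integral>\<^sup>+b. ennreal (chernoff u x K c a b w)
      \<partial>noise_space n \<partial>noise_space n \<partial>(noise_space n \<Otimes>\<^sub>M noise_space n))
    = ennreal (chernoff_rate u x ^ K)"
proof -
  let ?p = "u / (c \<bullet> c)" and ?\<Omega> = "noise_space n"
  define h where "h z = ennreal (exp (- u * x)) * ennreal (exp (?p * z\<^sup>2))" for z :: real
  have cc_pos: "0 < c \<bullet> c" using \<open>c \<noteq> 0\<close> by simp
  have "ennreal (chernoff u x K c a b w) = (\<Prod>k<K. h (c \<bullet> block_at K a b w k))" for a b w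
  proof -
    have "u * (energy K c a b w / (c \<bullet> c) - real K * x)
        = (\<Sum>k<K. - u * x + ?p * (c \<bullet> block_at K a b w k)\<^sup>2)"
      by (simp add: energy_def sum_subtractf sum_distrib_left sum_divide_distrib algebra_simps)
    then show ?thesis
      by (simp add: chernoff_def h_def exp_sum prod_ennreal[symmetric] exp_add[symmetric]
        ennreal_mult[symmetric])
  qed
  then have "(\<integral>\<^sup>+w. \<integral>\<^sup>+a. \<integral>\<^sup>+b. ennreal (chernoff u x K c a b w) \<partial>?\<Omega> \<partial>?\<Omega> \<partial>(?\<Omega> \<Otimes>\<^sub>M ?\<Omega>))
      = gauss_mean h (c \<bullet> c) 0 ^ K"
    using nn_integral_prod_block_form[OF _ slots, of h c] by (simp add: h_def[abs_def])
  also have "gauss_mean h (c \<bullet> c) 0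
      = ennreal (exp (- u * x)) * gauss_mean (\<lambda>z. ennreal (exp (?p * z\<^sup>2))) (c \<bullet> c) 0"
    unfolding h_def gauss_mean_def by (intro nn_integral_cmult) measurable
  also have "\<dots> = ennreal (chernoff_rate u x)"
    using gauss_mean_exp_square[of "c \<bullet> c" ?p] \<open>2 * u < 1\<close> cc_pos
    by (simp add: chernoff_rate_def ennreal_mult[symmetric])
  finally show ?thesis
    using \<open>2 * u < 1\<close> by (simp add: ennreal_power chernoff_rate_def)
qed

lemma chernoff_rate_less_1:
  assumes "\<bar>u\<bar> \<le> 1/4" and "4 * u\<^sup>2 < u * (x - 1)"
  shows "chernoff_rate u x < 1"
proof -
  have pos: "0 < 1 - 2 * u" using assms(1) by auto
  have "\<bar>ln (1 + - 2 * u) - - 2 * u\<bar> \<le> 2 * (- 2 * u)\<^sup>2"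
    using assms(1) by (intro abs_ln_one_plus_x_minus_x_bound) auto
  then have "- u * x < ln (1 - 2 * u) / 2"
    using assms(2) by (simp add: algebra_simps power2_eq_square)
  then have "exp (- u * x) < exp (ln (sqrt (1 - 2 * u)))"
    using pos by (simp add: ln_sqrt)
  then show ?thesis using pos by (simp add: chernoff_rate_def)
qed

lemma chernoff_le_imp_energy_le:
  assumes "0 < t" "c \<noteq> 0" "chernoff t x K c a b w \<le> p"
  shows "energy K c a b w \<le> (c \<bullet> c) * (real K * x + p / t)"
proof -
  have cc_pos: "0 < c \<bullet> c" using assms(2) by simp
  have "1 + t * (energy K c a b w / (c \<bullet> c) - real K * x) \<le> p"
    using assms(3) unfolding chernoff_def by (rule order_trans[OF exp_ge_add_one_self])
  then have "energy K c a b w / (c \<bullet> c) - real K * x \<le> p / t"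
    using assms(1) by (simp add: pos_le_divide_eq mult.commute)
  then show ?thesis using cc_pos by (simp add: pos_divide_le_eq mult.commute diff_le_eq add.commute)
qed

lemma chernoff_less_1_imp_energy_le:
  assumes "0 < t" "c \<noteq> 0" "chernoff t x K c a b w < 1"
  shows "energy K c a b w \<le> (c \<bullet> c) * (real K * x)"
  using assms by (simp add: chernoff_def mult_less_0_iff pos_divide_less_eq mult.commute less_imp_le)

lemma chernoff_less_1_imp_energy_ge:
  assumes "0 < t" "c \<noteq> 0" "chernoff (- t) x K c a b w < 1"
  shows "(c \<bullet> c) * (real K * x) \<le> energy K c a b w"
  using assms by (simp add: chernoff_def zero_less_mult_iff pos_less_divide_eq mult.commute less_imp_le)

section \<open>The two-slot feedback scheme\<close>

definition gauss_capacity :: "real \<Rightarrow> real" where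
  "gauss_capacity snr = ln (1 + snr) / 2"

definition block_lratio :: "real \<Rightarrow> real \<Rightarrow> real \<Rightarrow> real \<Rightarrow> nat \<Rightarrow>
    signal \<Rightarrow> signal \<Rightarrow> signal \<Rightarrow> signal \<Rightarrow> real" where
  "block_lratio N N' v v' K x x' y y' = (\<Prod>k<K. lratio N v (x k) (y k) * lratio N' v' (x' k) (y' k))"

lemma block_lratio_measurable:
  assumes "\<And>k. k < K \<Longrightarrow> (\<lambda>\<omega>. x \<omega> k) \<in> borel_measurable M" "\<And>k. k < K \<Longrightarrow> (\<lambda>\<omega>. x' \<omega> k) \<in> borel_measurable M"
    "\<And>k. k < K \<Longrightarrow> (\<lambda>\<omega>. y \<omega> k) \<in> borel_measurable M" "\<And>k. k < K \<Longrightarrow> (\<lambda>\<omega>. y' \<omega> k) \<in> borel_measurable M"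
  shows "(\<lambda>\<omega>. block_lratio N N' v v' K (x \<omega>) (x' \<omega>) (y \<omega>) (y' \<omega>)) \<in> borel_measurable M"
  unfolding block_lratio_def
  by (intro borel_measurable_prod borel_measurable_times lratio_measurable assms) auto

lemma ennreal_block_lratio:
  "ennreal (block_lratio N N' v v' K x x' y y') =
    (\<Prod>k<K. ennreal (lratio N v (x k) (y k) * lratio N' v' (x' k) (y' k)))"
  unfolding block_lratio_def by (intro prod_ennreal[symmetric] mult_nonneg_nonneg lratio_nonneg)

lemma prod_lratio_ge:
  assumes variances: "0 < N" "0 \<le> v"
    and noise: "(\<Sum>k<K. (y k - x k)\<^sup>2) \<le> N * (real K * (1 + \<eta>))"
    and signal: "(N + v) * (real K * (1 - \<eta>)) \<le> (\<Sum>k<K. (y k)\<^sup>2)"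
  shows "exp (real K * (gauss_capacity (v / N) - \<eta>)) \<le> (\<Prod>k<K. lratio N v (x k) (y k))"
proof -
  have "0 < 1 + v / N" using variances by (simp add: add_pos_nonneg)
  then have "(\<Prod>k<K. lratio N v (x k) (y k)) = exp (real K * gauss_capacity (v / N)
      + ((\<Sum>k<K. (y k)\<^sup>2) / (2 * (N + v)) - (\<Sum>k<K. (y k - x k)\<^sup>2) / (2 * N)))"
    using variances
    by (simp add: lratio_eq_exp prod.distrib exp_sum[symmetric] sum_subtractf
      sum_divide_distrib[symmetric] exp_add gauss_capacity_def exp_of_nat_mult ln_sqrt[symmetric])
  moreover have "(\<Sum>k<K. (y k - x k)\<^sup>2) / (2 * N) \<le> real K * (1 + \<eta>) / 2"
    using noise variances by (simp add: field_simps)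
  moreover have "real K * (1 - \<eta>) / 2 \<le> (\<Sum>k<K. (y k)\<^sup>2) / (2 * (N + v))"
    using signal variances by (simp add: field_simps)
  ultimately show ?thesis by (simp add: algebra_simps)
qed

lemma block_lratio_ge:
  assumes "0 < N" "0 \<le> v" "0 < N'" "0 \<le> v'"
    and "(\<Sum>k<K. (y k - x k)\<^sup>2) \<le> N * (real K * (1 + \<eta>))"
    and "(N + v) * (real K * (1 - \<eta>)) \<le> (\<Sum>k<K. (y k)\<^sup>2)"
    and "(\<Sum>k<K. (y' k - x' k)\<^sup>2) \<le> N' * (real K * (1 + \<eta>))"
    and "(N' + v') * (real K * (1 - \<eta>)) \<le> (\<Sum>k<K. (y' k)\<^sup>2)"
  shows "exp (real K * (gauss_capacity (v / N) + gauss_capacity (v' / N') - 2 * \<eta>))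
    \<le> block_lratio N N' v v' K x x' y y'"
proof -
  have "exp (real K * (gauss_capacity (v / N) + gauss_capacity (v' / N') - 2 * \<eta>))
      = exp (real K * (gauss_capacity (v / N) - \<eta>)) * exp (real K * (gauss_capacity (v' / N') - \<eta>))"
    by (simp add: exp_add[symmetric] algebra_simps)
  also have "\<dots> \<le> block_lratio N N' v v' K x x' y y'"
    unfolding block_lratio_def prod.distrib
    using assms by (intro mult_mono prod_lratio_ge prod_nonneg) (auto simp: lratio_nonneg)
  finally show ?thesis .
qed

text \<open>In a block of two channel uses user \<open>i\<close> sends \<open>a\<^sub>i u\<^sub>i\<close> and then \<open>b\<^sub>i u\<^sub>i + d\<^sub>i u\<^sub>i'\<close> with a fresh symbol
  \<open>u\<^sub>i'\<close>, and user 2 adds \<open>\<alpha>\<close> times the feedback of the first use. The choice of \<open>b\<^sub>1\<close> and \<open>b\<^sub>2\<close> means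
  \<open>a\<^sub>1 b\<^sub>1 + a\<^sub>2 b\<^sub>2 = 0\<close>. Rates and powers are those of a block, hence twice those of a channel use.\<close>

locale two_slot_scheme =
  fixes N s a1 a2 d1 d2 \<kappa> \<alpha> :: real
  assumes noise_variances: "0 < N" "0 \<le> s" and amplitudes: "0 < a1" "0 < a2" "0 < d1" "0 < d2"
begin

abbreviation b1 :: real where "b1 \<equiv> - (\<kappa> * a2)"
abbreviation b2 :: real where "b2 \<equiv> \<kappa> * a1"

definition N' :: real where "N' = N + \<alpha>\<^sup>2 * s"

lemma N'_pos: "0 < N'"
  using noise_variances by (simp add: N'_def add_pos_nonneg)

definition info1 :: real where
  "info1 = gauss_capacity (a1\<^sup>2 / N) + gauss_capacity (d1\<^sup>2 / N')"

definition info2 :: real where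
  "info2 = gauss_capacity (a2\<^sup>2 / N) + gauss_capacity (d2\<^sup>2 / N')"

definition info12 :: real where
  "info12 = gauss_capacity ((a1\<^sup>2 + a2\<^sup>2) / N)
    + gauss_capacity ((\<kappa>\<^sup>2 * (a1\<^sup>2 + a2\<^sup>2) + d1\<^sup>2 + d2\<^sup>2) / N')"

definition pow1 :: real where
  "pow1 = a1\<^sup>2 + b1\<^sup>2 + d1\<^sup>2"

definition pow2 :: real where
  "pow2 = a2\<^sup>2 + (\<alpha> * a1)\<^sup>2 + (b2 + \<alpha> * a2)\<^sup>2 + d2\<^sup>2 + \<alpha>\<^sup>2 * N + \<alpha>\<^sup>2 * s"

lemma pow_nonneg: "0 \<le> pow1" "0 \<le> pow2"
  using noise_variances by (simp_all add: pow1_def pow2_def)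

end

text \<open>Block \<open>k\<close> consists of the times \<open>k\<close> and \<open>K + k\<close>. The entries \<open>k\<close> and \<open>K + k\<close> of a codeword
  are the symbol sent in both slots and the fresh one. The parameters \<open>\<eta>\<close> and \<open>t\<close> are the typicality
  slack and the Chernoff exponent.\<close>

locale two_slot_code = two_slot_scheme +
  fixes \<eta> t :: real and n :: nat
  assumes slack: "0 < \<eta>" and exponent: "0 < t" "t < 1/2"
begin

abbreviation K :: nat where "K \<equiv> n div 2"
abbreviation \<Omega> :: "signal measure" where "\<Omega> \<equiv> noise_space n"
abbreviation Y :: "signal measure" where "Y \<equiv> PiM {..<n} (\<lambda>_. borel)"

lemma double_K_le: "2 * K \<le> n"
  by simp

lemma slot_measurable:
  assumes "k < K"
  shows "(\<lambda>x. x k) \<in> borel_measurable \<Omega>" "(\<lambda>x. x (K + k)) \<in> borel_measurable \<Omega>"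
    and "(\<lambda>y. y k) \<in> borel_measurable Y" "(\<lambda>y. y (K + k)) \<in> borel_measurable Y"
  using assms by (auto intro!: noise_space_component measurable_component_singleton)

definition signal1 :: "signal \<Rightarrow> signal" where
  "signal1 a i = (if i < K then a1 * a i else if i < 2 * K then b1 * a (i - K) + d1 * a i else 0)"

definition signal2 :: "signal \<Rightarrow> signal \<Rightarrow> signal" where
  "signal2 b v i = (if i < K then a2 * b i
     else if i < 2 * K then b2 * b (i - K) + d2 * b i + \<alpha> * v (i - K) else 0)"

definition feedback :: "signal \<Rightarrow> signal \<Rightarrow> signal \<times> signal \<Rightarrow> signal" where
  "feedback a b w i = a1 * a i + a2 * b i + sqrt N * fst w i + sqrt s * snd w i"

definition received :: "signal \<Rightarrow> signal \<Rightarrow> signal \<times> signal \<Rightarrow> signal" where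
  "received a b w = (\<lambda>i\<in>{..<n}. signal1 a i + signal2 b (feedback a b w) i + sqrt N * fst w i)"

lemma signal2_measurable:
  assumes "i < n" and [measurable]: "f \<in> measurable L \<Omega>" "g \<in> measurable L \<Omega>" "h \<in> measurable L (\<Omega> \<Otimes>\<^sub>M \<Omega>)"
  shows "(\<lambda>x. signal2 (g x) (feedback (f x) (g x) (h x)) i) \<in> borel_measurable L"
proof -
  have "i < n" "i - K < n" using assms(1) by auto
  note [measurable] = this[THEN noise_space_component]
  show ?thesis
    unfolding signal2_def feedback_def by (cases "i < K"; cases "i < 2 * K"; simp; measurable)
qed

lemma received_measurable: "(\<lambda>(a, b, w). received a b w) \<in> measurable (\<Omega> \<Otimes>\<^sub>M \<Omega> \<Otimes>\<^sub>M (\<Omega> \<Otimes>\<^sub>M \<Omega>)) Y"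
  unfolding received_def split_beta'
proof (rule measurable_restrict)
  fix i assume "i \<in> {..<n}"
  then have i: "i < n" "i - K < n" by auto
  note [measurable] = i[THEN noise_space_component] signal2_measurable[OF i(1)]
  show "(\<lambda>p. signal1 (fst p) i + signal2 (fst (snd p)) (feedback (fst p) (fst (snd p)) (snd (snd p))) i
      + sqrt N * fst (snd (snd p)) i) \<in> borel_measurable (\<Omega> \<Otimes>\<^sub>M \<Omega> \<Otimes>\<^sub>M (\<Omega> \<Otimes>\<^sub>M \<Omega>))"
    unfolding signal1_def by (cases "i < K"; cases "i < 2 * K"; simp; measurable)
qed

lemma received_first_slot:
  "k < K \<Longrightarrow> received a b w k = (a1, 0, a2, 0, sqrt N, 0, 0) \<bullet> block_at K a b w k"
  by (auto simp: received_def signal1_def signal2_def block_at_def)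

lemma received_second_slot:
  "k < K \<Longrightarrow> received a b w (K + k) - \<alpha> * received a b w k
    = (b1, d1, b2, d2, 0, sqrt N, \<alpha> * sqrt s) \<bullet> block_at K a b w k"
  unfolding received_first_slot
  by (auto simp: received_def signal1_def signal2_def feedback_def block_at_def algebra_simps)

subsection \<open>Likelihood ratios of the codewords\<close>

definition user_lratio :: "real \<Rightarrow> real \<Rightarrow> real \<Rightarrow> signal \<Rightarrow> signal \<Rightarrow> signal \<Rightarrow> real" where
  "user_lratio p q c x y z =
     block_lratio N N' (p\<^sup>2) (q\<^sup>2) K (\<lambda>k. p * x k) (\<lambda>k. q * x (K + k)) y (\<lambda>k. z k - c * x k)"

text \<open>The likelihood ratios of the individual users discard what the second slot tells about the first
  symbols. This keeps the integrals one-dimensional, and only the sum rate has to be exact.\<close>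

definition lratio1 :: "signal \<Rightarrow> signal \<Rightarrow> signal \<Rightarrow> real" where
  "lratio1 a b y = user_lratio a1 d1 b1 a (\<lambda>k. y k - a2 * b k)
     (\<lambda>k. y (K + k) - \<alpha> * y k - b2 * b k - d2 * b (K + k))"

definition lratio2 :: "signal \<Rightarrow> signal \<Rightarrow> signal \<Rightarrow> real" where
  "lratio2 a b y = user_lratio a2 d2 b2 b (\<lambda>k. y k - a1 * a k)
     (\<lambda>k. y (K + k) - \<alpha> * y k - b1 * a k - d1 * a (K + k))"

definition lratio12 :: "signal \<Rightarrow> signal \<Rightarrow> signal \<Rightarrow> real" where
  "lratio12 a b y = block_lratio N N' (a1\<^sup>2 + a2\<^sup>2) (\<kappa>\<^sup>2 * (a1\<^sup>2 + a2\<^sup>2) + d1\<^sup>2 + d2\<^sup>2) K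
     (\<lambda>k. a1 * a k + a2 * b k) (\<lambda>k. \<kappa> * (a1 * b k - a2 * a k) + d1 * a (K + k) + d2 * b (K + k))
     y (\<lambda>k. y (K + k) - \<alpha> * y k)"

lemma lratio_codewords_measurable:
  "(\<lambda>(a, b, y). lratio1 a b y) \<in> borel_measurable (\<Omega> \<Otimes>\<^sub>M \<Omega> \<Otimes>\<^sub>M Y)"
  "(\<lambda>(a, b, y). lratio2 a b y) \<in> borel_measurable (\<Omega> \<Otimes>\<^sub>M \<Omega> \<Otimes>\<^sub>M Y)"
  "(\<lambda>(a, b, y). lratio12 a b y) \<in> borel_measurable (\<Omega> \<Otimes>\<^sub>M \<Omega> \<Otimes>\<^sub>M Y)"
proof -
  have slots: "(\<lambda>p. fst p k) \<in> borel_measurable (\<Omega> \<Otimes>\<^sub>M \<Omega> \<Otimes>\<^sub>M Y)"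
    "(\<lambda>p. fst p (K + k)) \<in> borel_measurable (\<Omega> \<Otimes>\<^sub>M \<Omega> \<Otimes>\<^sub>M Y)"
    "(\<lambda>p. fst (snd p) k) \<in> borel_measurable (\<Omega> \<Otimes>\<^sub>M \<Omega> \<Otimes>\<^sub>M Y)"
    "(\<lambda>p. fst (snd p) (K + k)) \<in> borel_measurable (\<Omega> \<Otimes>\<^sub>M \<Omega> \<Otimes>\<^sub>M Y)"
    "(\<lambda>p. snd (snd p) k) \<in> borel_measurable (\<Omega> \<Otimes>\<^sub>M \<Omega> \<Otimes>\<^sub>M Y)"
    "(\<lambda>p. snd (snd p) (K + k)) \<in> borel_measurable (\<Omega> \<Otimes>\<^sub>M \<Omega> \<Otimes>\<^sub>M Y)" if "k < K" for k
    using slot_measurable[OF that, measurable] by measurable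
  show "(\<lambda>(a, b, y). lratio1 a b y) \<in> borel_measurable (\<Omega> \<Otimes>\<^sub>M \<Omega> \<Otimes>\<^sub>M Y)"
    "(\<lambda>(a, b, y). lratio2 a b y) \<in> borel_measurable (\<Omega> \<Otimes>\<^sub>M \<Omega> \<Otimes>\<^sub>M Y)"
    "(\<lambda>(a, b, y). lratio12 a b y) \<in> borel_measurable (\<Omega> \<Otimes>\<^sub>M \<Omega> \<Otimes>\<^sub>M Y)"
    unfolding lratio1_def lratio2_def lratio12_def user_lratio_def split_beta'
    by (intro block_lratio_measurable borel_measurable_add borel_measurable_diff borel_measurable_times
      borel_measurable_const slots; assumption)+
qed

lemma nn_integral_user_lratio: "(\<integral>\<^sup>+x. ennreal (user_lratio p q c x y z) \<partial>\<Omega>) = 1"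
proof -
  have "(\<integral>\<^sup>+x. ennreal (user_lratio p q c x y z) \<partial>\<Omega>)
      = (\<Prod>k<K. \<integral>\<^sup>+u. \<integral>\<^sup>+v. ennreal (lratio N (p\<^sup>2) (p * u) (y k) * lratio N' (q\<^sup>2) (q * v) (z k - c * u))
          \<partial>std_normal \<partial>std_normal)"
    unfolding user_lratio_def ennreal_block_lratio
    by (rule nn_integral_noise_space_prod_pairs[OF _ double_K_le]) (simp add: split_beta')
  also have "\<dots> = 1"
    using noise_variances N'_pos
    by (simp add: ennreal_mult lratio_nonneg nn_integral_cmult nn_integral_lratio_eq_1)
  finally show ?thesis .
qed

lemma nn_integral_lratio1: "(\<integral>\<^sup>+a. ennreal (lratio1 a b y) \<partial>\<Omega>) = 1"
  and nn_integral_lratio2: "(\<integral>\<^sup>+b. ennreal (lratio2 a b y) \<partial>\<Omega>) = 1"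
  unfolding lratio1_def lratio2_def by (rule nn_integral_user_lratio)+

lemma nn_integral_lratio12_block:
  "(\<integral>\<^sup>+u. \<integral>\<^sup>+u'. \<integral>\<^sup>+v. \<integral>\<^sup>+v'. ennreal (lratio N (a1\<^sup>2 + a2\<^sup>2) (a1 * u + a2 * v) y *
     lratio N' (\<kappa>\<^sup>2 * (a1\<^sup>2 + a2\<^sup>2) + d1\<^sup>2 + d2\<^sup>2) (\<kappa> * (a1 * v - a2 * u) + d1 * u' + d2 * v') z)
    \<partial>std_normal \<partial>std_normal \<partial>std_normal \<partial>std_normal) = 1" (is "?L = 1")
proof -
  interpret S: prob_space std_normal by (rule prob_space_std_normal)
  interpret SS: pair_sigma_finite std_normal std_normal ..
  define r where "r = a1\<^sup>2 + a2\<^sup>2"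
  have r_nonneg: "0 \<le> r" by (simp add: r_def)
  have pos: "0 < N' + d2\<^sup>2" "0 < N' + d2\<^sup>2 + d1\<^sup>2" "0 \<le> \<kappa>\<^sup>2 * r + d1\<^sup>2" "0 \<le> \<kappa>\<^sup>2 * r"
    using N'_pos r_nonneg by (auto intro!: add_pos_nonneg)
  have "?L = (\<integral>\<^sup>+u. \<integral>\<^sup>+u'. \<integral>\<^sup>+v. ennreal (lratio N r (a1 * u + a2 * v) y) *
      ennreal (lratio (N' + d2\<^sup>2) (\<kappa>\<^sup>2 * r + d1\<^sup>2) (\<kappa> * (a1 * v - a2 * u) + d1 * u') z)
      \<partial>std_normal \<partial>std_normal \<partial>std_normal)"
    unfolding r_def[symmetric]
    by (simp add: ennreal_mult lratio_nonneg nn_integral_cmult nn_integral_lratio[OF N'_pos pos(3)])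
  also have "\<dots> = (\<integral>\<^sup>+u. \<integral>\<^sup>+v. \<integral>\<^sup>+u'. ennreal (lratio N r (a1 * u + a2 * v) y) *
      ennreal (lratio (N' + d2\<^sup>2) (\<kappa>\<^sup>2 * r + d1\<^sup>2) (\<kappa> * (a1 * v - a2 * u) + d1 * u') z)
      \<partial>std_normal \<partial>std_normal \<partial>std_normal)"
    by (intro nn_integral_cong SS.Fubini') (simp add: split_beta')
  also have "\<dots> = (\<integral>\<^sup>+u. \<integral>\<^sup>+v. ennreal (lratio N r (a1 * u + a2 * v) y *
      lratio (N' + d2\<^sup>2 + d1\<^sup>2) (\<kappa>\<^sup>2 * r) (\<kappa> * (a1 * v - a2 * u)) z) \<partial>std_normal \<partial>std_normal)"
    by (simp add: ennreal_mult lratio_nonneg nn_integral_cmult nn_integral_lratio[OF pos(1,4)])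
  also have "\<dots> = 1"
    unfolding r_def by (rule nn_integral_lratio_orthogonal[OF noise_variances(1) pos(2)])
  finally show ?thesis .
qed

lemma nn_integral_lratio12: "(\<integral>\<^sup>+a. \<integral>\<^sup>+b. ennreal (lratio12 a b y) \<partial>\<Omega> \<partial>\<Omega>) = 1"
proof -
  interpret S: prob_space std_normal by (rule prob_space_std_normal)
  let ?F = "\<lambda>k u u' v v'. ennreal (lratio N (a1\<^sup>2 + a2\<^sup>2) (a1 * u + a2 * v) (y k) *
     lratio N' (\<kappa>\<^sup>2 * (a1\<^sup>2 + a2\<^sup>2) + d1\<^sup>2 + d2\<^sup>2) (\<kappa> * (a1 * v - a2 * u) + d1 * u' + d2 * v')
       (y (K + k) - \<alpha> * y k))"
  have "(\<integral>\<^sup>+a. \<integral>\<^sup>+b. ennreal (lratio12 a b y) \<partial>\<Omega> \<partial>\<Omega>)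
      = (\<integral>\<^sup>+a. (\<Prod>k<K. \<integral>\<^sup>+v. \<integral>\<^sup>+v'. ?F k (a k) (a (K + k)) v v' \<partial>std_normal \<partial>std_normal) \<partial>\<Omega>)"
    unfolding lratio12_def ennreal_block_lratio
    by (intro nn_integral_cong nn_integral_noise_space_prod_pairs) (auto simp: split_beta')
  also have "\<dots> = (\<Prod>k<K. \<integral>\<^sup>+u. \<integral>\<^sup>+u'. \<integral>\<^sup>+v. \<integral>\<^sup>+v'. ?F k u u' v v'
      \<partial>std_normal \<partial>std_normal \<partial>std_normal \<partial>std_normal)"
    by (rule nn_integral_noise_space_prod_pairs) (auto simp: split_beta')
  also have "\<dots> = 1"
    by (simp only: nn_integral_lratio12_block prod.neutral_const)
  finally show ?thesis .
qed

subsection \<open>Typical behaviour of the transmitted codewords\<close>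

text \<open>The forms whose empirical energy must not be too large (noises and channel inputs) and those
  whose empirical energy must not be too small (outputs, possibly with one user removed).\<close>

definition upper_forms :: "block set" where
  "upper_forms = {(0, 0, 0, 0, sqrt N, 0, 0), (0, 0, 0, 0, 0, sqrt N, \<alpha> * sqrt s),
     (a1, 0, 0, 0, 0, 0, 0), (b1, d1, 0, 0, 0, 0, 0), (0, 0, a2, 0, 0, 0, 0),
     (\<alpha> * a1, 0, b2 + \<alpha> * a2, d2, \<alpha> * sqrt N, 0, \<alpha> * sqrt s)}"

definition lower_forms :: "block set" where
  "lower_forms = {(a1, 0, a2, 0, sqrt N, 0, 0), (b1, d1, b2, d2, 0, sqrt N, \<alpha> * sqrt s),
     (a1, 0, 0, 0, sqrt N, 0, 0), (0, d1, 0, 0, 0, sqrt N, \<alpha> * sqrt s),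
     (0, 0, a2, 0, sqrt N, 0, 0), (0, 0, 0, d2, 0, sqrt N, \<alpha> * sqrt s)}"

lemma finite_forms: "finite upper_forms" "finite lower_forms"
  by (simp_all add: upper_forms_def lower_forms_def)

lemma forms_nonzero: "c \<in> upper_forms \<union> lower_forms \<Longrightarrow> c \<noteq> 0"
  using noise_variances amplitudes by (auto simp: upper_forms_def lower_forms_def zero_prod_def)

lemma card_forms: "card upper_forms \<le> 6" "card lower_forms \<le> 6"
proof -
  have "card {c1, c2, c3, c4, c5, c6} \<le> 6" for c1 c2 c3 c4 c5 c6 :: block
    using card_length[of "[c1, c2, c3, c4, c5, c6]"] by simp
  then show "card upper_forms \<le> 6" "card lower_forms \<le> 6"
    by (simp_all only: upper_forms_def lower_forms_def)
qed

definition penalty :: "signal \<Rightarrow> signal \<Rightarrow> signal \<times> signal \<Rightarrow> real" where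
  "penalty a b w = (\<Sum>c\<in>upper_forms. chernoff t (1 + \<eta>) K c a b w)
     + (\<Sum>c\<in>lower_forms. chernoff (- t) (1 - \<eta>) K c a b w)"

definition penalty_bound :: real where
  "penalty_bound = 6 * chernoff_rate t (1 + \<eta>) ^ K + 6 * chernoff_rate (- t) (1 - \<eta>) ^ K"

lemma penalty_nonneg: "0 \<le> penalty a b w"
  unfolding penalty_def chernoff_def by (intro add_nonneg_nonneg sum_nonneg) auto

lemma chernoff_upper_le_penalty: "c \<in> upper_forms \<Longrightarrow> chernoff t (1 + \<eta>) K c a b w \<le> penalty a b w"
  and chernoff_lower_le_penalty: "c \<in> lower_forms \<Longrightarrow> chernoff (- t) (1 - \<eta>) K c a b w \<le> penalty a b w"
proof -
  have nonneg: "0 \<le> chernoff u x K c a b w" for u x c by (simp add: chernoff_def)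
  show "chernoff t (1 + \<eta>) K c a b w \<le> penalty a b w" if "c \<in> upper_forms"
    unfolding penalty_def using that finite_forms
    by (intro add_increasing2 sum_nonneg nonneg member_le_sum) auto
  show "chernoff (- t) (1 - \<eta>) K c a b w \<le> penalty a b w" if "c \<in> lower_forms"
    unfolding penalty_def using that finite_forms
    by (intro add_increasing sum_nonneg nonneg member_le_sum[of c lower_forms]) auto
qed

definition energy_budget :: "real \<Rightarrow> real" where
  "energy_budget z = real K * (1 + \<eta>) + z / t"

lemma energy_le_penalty:
  "c \<in> upper_forms \<Longrightarrow> energy K c a b w \<le> (c \<bullet> c) * energy_budget (penalty a b w)"
  unfolding energy_budget_def using exponent forms_nonzero chernoff_upper_le_penalty
  by (intro chernoff_le_imp_energy_le) auto

lemma typical_energy_le: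
  "penalty a b w < 1 \<Longrightarrow> c \<in> upper_forms \<Longrightarrow> energy K c a b w \<le> (c \<bullet> c) * (real K * (1 + \<eta>))"
  using exponent forms_nonzero chernoff_upper_le_penalty[of c a b w]
  by (intro chernoff_less_1_imp_energy_le) auto

lemma typical_energy_ge:
  "penalty a b w < 1 \<Longrightarrow> c \<in> lower_forms \<Longrightarrow> (c \<bullet> c) * (real K * (1 - \<eta>)) \<le> energy K c a b w"
  using exponent forms_nonzero chernoff_lower_le_penalty[of c a b w]
  by (intro chernoff_less_1_imp_energy_ge) auto

lemma penalty_measurable:
  assumes "f \<in> measurable L \<Omega>" "g \<in> measurable L \<Omega>" "h \<in> measurable L (\<Omega> \<Otimes>\<^sub>M \<Omega>)"
  shows "(\<lambda>x. penalty (f x) (g x) (h x)) \<in> borel_measurable L"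
proof -
  note [measurable] = energy_measurable[OF double_K_le assms]
  show ?thesis unfolding penalty_def chernoff_def by measurable
qed

lemma nn_integral_penalty:
  "(\<integral>\<^sup>+w. \<integral>\<^sup>+a. \<integral>\<^sup>+b. ennreal (penalty a b w) \<partial>\<Omega> \<partial>\<Omega> \<partial>(\<Omega> \<Otimes>\<^sub>M \<Omega>)) \<le> ennreal penalty_bound"
proof -
  interpret O: prob_space \<Omega> by (rule prob_space_noise_space)
  let ?P = "(\<Omega> \<Otimes>\<^sub>M \<Omega>) \<Otimes>\<^sub>M \<Omega> \<Otimes>\<^sub>M \<Omega>"
  note sigma_finite = O.sigma_finite_measure_axioms
  note iterate = nn_integral_pair_measure3[OF sigma_finite sigma_finite]
  define f where "f u x c = (\<lambda>(w, a, b). ennreal (chernoff u x K c a b w))" for u x c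
  have f_measurable: "f u x c \<in> borel_measurable ?P" for u x c
    unfolding f_def chernoff_def split_beta'
    using energy_measurable[OF double_K_le, measurable] by measurable
  have f_integral: "(\<integral>\<^sup>+p. f u x c p \<partial>?P) = ennreal (chernoff_rate u x ^ K)"
    if "c \<in> upper_forms \<union> lower_forms" "2 * u < 1" for u x c
    using iterate[OF f_measurable[unfolded f_def]]
      nn_integral_chernoff[OF that(2) forms_nonzero[OF that(1)] double_K_le] by (simp add: f_def)
  have rate: "0 \<le> chernoff_rate t (1 + \<eta>)" "0 \<le> chernoff_rate (- t) (1 - \<eta>)"
    using exponent by (simp_all add: chernoff_rate_def)
  have penalty: "(\<lambda>(w, a, b). ennreal (penalty a b w))
      = (\<lambda>p. (\<Sum>c\<in>upper_forms. f t (1 + \<eta>) c p) + (\<Sum>c\<in>lower_forms. f (- t) (1 - \<eta>) c p))"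
    by (auto simp: f_def penalty_def chernoff_def sum_nonneg simp flip: ennreal_plus)
  have "(\<integral>\<^sup>+w. \<integral>\<^sup>+a. \<integral>\<^sup>+b. ennreal (penalty a b w) \<partial>\<Omega> \<partial>\<Omega> \<partial>(\<Omega> \<Otimes>\<^sub>M \<Omega>))
      = (\<integral>\<^sup>+(w, a, b). ennreal (penalty a b w) \<partial>?P)"
    by (rule iterate[symmetric])
      (unfold penalty, intro borel_measurable_add borel_measurable_sum f_measurable)
  also have "\<dots> = (\<Sum>c\<in>upper_forms. \<integral>\<^sup>+p. f t (1 + \<eta>) c p \<partial>?P)
      + (\<Sum>c\<in>lower_forms. \<integral>\<^sup>+p. f (- t) (1 - \<eta>) c p \<partial>?P)"
    unfolding penalty by (simp add: nn_integral_add nn_integral_sum borel_measurable_sum f_measurable)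
  also have "\<dots> = ennreal (real (card upper_forms) * chernoff_rate t (1 + \<eta>) ^ K
      + real (card lower_forms) * chernoff_rate (- t) (1 - \<eta>) ^ K)"
    using rate exponent by (simp add: f_integral ennreal_mult ennreal_of_nat_eq_real_of_nat)
  also have "\<dots> \<le> ennreal penalty_bound"
    unfolding penalty_bound_def using rate card_forms
    by (intro ennreal_leI add_mono mult_right_mono zero_le_power) simp_all
  finally show ?thesis .
qed

lemma typical_block_lratio_ge:
  assumes typical: "penalty a b w < 1"
    and forms: "c \<in> lower_forms" "c' \<in> lower_forms"
    and variances: "c \<bullet> c = N + v" "c' \<bullet> c' = N' + v'" "0 \<le> v" "0 \<le> v'"
    and y: "\<And>k. k < K \<Longrightarrow> y k = c \<bullet> block_at K a b w k" "\<And>k. k < K \<Longrightarrow> y' k = c' \<bullet> block_at K a b w k"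
    and noise: "\<And>k. k < K \<Longrightarrow> y k - x k = sqrt N * fst w k"
      "\<And>k. k < K \<Longrightarrow> y' k - x' k = sqrt N * fst w (K + k) + \<alpha> * sqrt s * snd w k"
  shows "exp (real K * (gauss_capacity (v / N) + gauss_capacity (v' / N') - 2 * \<eta>))
    \<le> block_lratio N N' v v' K x x' y y'"
proof (rule block_lratio_ge)
  note up = typical_energy_le[OF typical, unfolded energy_def]
    and lo = typical_energy_ge[OF typical, unfolded energy_def]
  show "(\<Sum>k<K. (y k - x k)\<^sup>2) \<le> N * (real K * (1 + \<eta>))"
    using up[of "(0, 0, 0, 0, sqrt N, 0, 0)"] noise_variances
    by (simp add: upper_forms_def block_at_def noise)
  show "(\<Sum>k<K. (y' k - x' k)\<^sup>2) \<le> N' * (real K * (1 + \<eta>))"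
    using up[of "(0, 0, 0, 0, 0, sqrt N, \<alpha> * sqrt s)"] noise_variances
    by (simp add: upper_forms_def block_at_def noise N'_def power2_eq_square algebra_simps)
  show "(N + v) * (real K * (1 - \<eta>)) \<le> (\<Sum>k<K. (y k)\<^sup>2)" "(N' + v') * (real K * (1 - \<eta>)) \<le> (\<Sum>k<K. (y' k)\<^sup>2)"
    using forms[THEN lo] by (simp_all add: y variances)
qed (use noise_variances N'_pos variances in auto)

lemma typical_lratio_ge:
  assumes "penalty a b w < 1"
  defines "y \<equiv> received a b w"
  shows "exp (real K * (info1 - 2 * \<eta>)) \<le> lratio1 a b y"
    and "exp (real K * (info2 - 2 * \<eta>)) \<le> lratio2 a b y"
    and "exp (real K * (info12 - 2 * \<eta>)) \<le> lratio12 a b y"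
proof -
  have y: "y k = a1 * a k + a2 * b k + sqrt N * fst w k"
    "y (K + k) = \<alpha> * y k + b1 * a k + d1 * a (K + k) + b2 * b k + d2 * b (K + k)
      + sqrt N * fst w (K + k) + \<alpha> * sqrt s * snd w k" if "k < K" for k
    using that received_second_slot[OF that, of a b w]
    by (simp_all add: y_def received_first_slot block_at_def algebra_simps)
  note lratio_ge = typical_block_lratio_ge[OF assms(1)]
  show "exp (real K * (info1 - 2 * \<eta>)) \<le> lratio1 a b y"
    unfolding info1_def lratio1_def user_lratio_def
    by (rule lratio_ge[of "(a1, 0, 0, 0, sqrt N, 0, 0)" "(0, d1, 0, 0, 0, sqrt N, \<alpha> * sqrt s)"])
      (use noise_variances in \<open>simp_all add: lower_forms_def block_at_def N'_def y power2_eq_square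
        distrib_left\<close>)
  show "exp (real K * (info2 - 2 * \<eta>)) \<le> lratio2 a b y"
    unfolding info2_def lratio2_def user_lratio_def
    by (rule lratio_ge[of "(0, 0, a2, 0, sqrt N, 0, 0)" "(0, 0, 0, d2, 0, sqrt N, \<alpha> * sqrt s)"])
      (use noise_variances in \<open>simp_all add: lower_forms_def block_at_def N'_def y power2_eq_square
        distrib_left\<close>)
  show "exp (real K * (info12 - 2 * \<eta>)) \<le> lratio12 a b y"
    unfolding info12_def lratio12_def
    by (rule lratio_ge[of "(a1, 0, a2, 0, sqrt N, 0, 0)" "(b1, d1, b2, d2, 0, sqrt N, \<alpha> * sqrt s)"])
      (use noise_variances in \<open>simp_all add: lower_forms_def block_at_def N'_def y power2_eq_square
        distrib_left distrib_right right_diff_distrib\<close>)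
qed

definition inv_threshold :: "real \<Rightarrow> ennreal" where
  "inv_threshold I = ennreal (exp (- (real K * (I - 2 * \<eta>))))"

lemma one_le_inv_threshold_mult:
  assumes "exp (real K * (I - 2 * \<eta>)) \<le> L"
  shows "1 \<le> inv_threshold I * ennreal L"
proof -
  have "1 \<le> exp (- (real K * (I - 2 * \<eta>))) * L"
    using assms by (simp only: exp_minus inverse_eq_divide) (simp add: pos_le_divide_eq)
  then show ?thesis
    using ennreal_leI by (fastforce simp: inv_threshold_def ennreal_mult'[symmetric])
qed

sublocale coding: mac_random_coding \<Omega> \<Omega> "\<Omega> \<Otimes>\<^sub>M \<Omega>" Y received
  "\<lambda>a b y. inv_threshold info12 * ennreal (lratio12 a b y)"
  "\<lambda>a b y. inv_threshold info1 * ennreal (lratio1 a b y)"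
  "\<lambda>a b y. inv_threshold info2 * ennreal (lratio2 a b y)"
  "\<lambda>a b w. ennreal (penalty a b w)"
  "inv_threshold info12" "inv_threshold info1" "inv_threshold info2"
proof -
  interpret O: prob_space \<Omega> by (rule prob_space_noise_space)
  interpret OO: pair_prob_space \<Omega> \<Omega> ..
  note [measurable] = lratio_codewords_measurable[THEN measurable_case_prod3_compose] penalty_measurable
  show "mac_random_coding \<Omega> \<Omega> (\<Omega> \<Otimes>\<^sub>M \<Omega>) Y received
    (\<lambda>a b y. inv_threshold info12 * ennreal (lratio12 a b y))
    (\<lambda>a b y. inv_threshold info1 * ennreal (lratio1 a b y))
    (\<lambda>a b y. inv_threshold info2 * ennreal (lratio2 a b y)) (\<lambda>a b w. ennreal (penalty a b w))
    (inv_threshold info12) (inv_threshold info1) (inv_threshold info2)"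
  proof
    show "(\<integral>\<^sup>+a. \<integral>\<^sup>+b. inv_threshold info12 * ennreal (lratio12 a b y) \<partial>\<Omega> \<partial>\<Omega>) \<le> inv_threshold info12"
      if [measurable]: "y \<in> space Y" for y
    proof -
      have "(\<integral>\<^sup>+a. \<integral>\<^sup>+b. inv_threshold info12 * ennreal (lratio12 a b y) \<partial>\<Omega> \<partial>\<Omega>)
          = (\<integral>\<^sup>+a. inv_threshold info12 * (\<integral>\<^sup>+b. ennreal (lratio12 a b y) \<partial>\<Omega>) \<partial>\<Omega>)"
        by (intro nn_integral_cong nn_integral_cmult) measurable
      also have "\<dots> = inv_threshold info12 * (\<integral>\<^sup>+a. \<integral>\<^sup>+b. ennreal (lratio12 a b y) \<partial>\<Omega> \<partial>\<Omega>)"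
        by (intro nn_integral_cmult) measurable
      finally show ?thesis by (simp add: nn_integral_lratio12)
    qed
    show "(\<integral>\<^sup>+a. inv_threshold info1 * ennreal (lratio1 a b y) \<partial>\<Omega>) \<le> inv_threshold info1"
      if [measurable]: "b \<in> space \<Omega>" "y \<in> space Y" for b y
      by (simp add: nn_integral_cmult nn_integral_lratio1)
    show "(\<integral>\<^sup>+b. inv_threshold info2 * ennreal (lratio2 a b y) \<partial>\<Omega>) \<le> inv_threshold info2"
      if [measurable]: "a \<in> space \<Omega>" "y \<in> space Y" for a y
      by (simp add: nn_integral_cmult nn_integral_lratio2)
    fix a b w
    assume failed: "inv_threshold info12 * ennreal (lratio12 a b (received a b w)) < 1 \<or>
      inv_threshold info1 * ennreal (lratio1 a b (received a b w)) < 1 \<or>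
      inv_threshold info2 * ennreal (lratio2 a b (received a b w)) < 1"
    have "\<not> penalty a b w < 1"
      using failed typical_lratio_ge[of a b w, THEN one_le_inv_threshold_mult]
      by (auto simp: not_le[symmetric])
    then show "1 \<le> ennreal (penalty a b w)" by simp
  qed (rule received_measurable, measurable)
qed

end

section \<open>Codes from codebooks\<close>

lemma sets_code_space:
  "sets (code_space c n) = sets (count_space UNIV \<Otimes>\<^sub>M (noise_space n \<Otimes>\<^sub>M noise_space n))"
  unfolding code_space_def by (intro sets_pair_measure_cong) auto

lemma code_space_measurable:
  assumes "\<And>m. f m \<in> measurable (noise_space n \<Otimes>\<^sub>M noise_space n) L"
  shows "(\<lambda>\<omega>. f (fst \<omega>) (snd \<omega>)) \<in> measurable (code_space c n) L"
  unfolding measurable_cong_sets[OF sets_code_space refl]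
  using assms by (intro measurable_pair_measure_countable1) auto

lemma prob_space_code_space:
  assumes "1 \<le> nmsg1 c" "1 \<le> nmsg2 c"
  shows "prob_space (code_space c n)"
proof -
  interpret O: prob_space "noise_space n" by (rule prob_space_noise_space)
  interpret OO: pair_prob_space "noise_space n" "noise_space n" ..
  interpret U: prob_space "uniform_measure (count_space UNIV) ({..<nmsg1 c} \<times> {..<nmsg2 c})"
    using assms by (intro prob_space_uniform_measure)
      (auto simp: emeasure_count_space_finite ennreal_mult_eq_top_iff)
  interpret UOO: pair_prob_space "uniform_measure (count_space UNIV) ({..<nmsg1 c} \<times> {..<nmsg2 c})"
    "noise_space n \<Otimes>\<^sub>M noise_space n" ..
  show ?thesis unfolding code_space_def by (rule UOO.P.prob_space_axioms)
qed

lemma nn_integral_code_space: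
  assumes f_measurable: "\<And>m. f m \<in> borel_measurable (noise_space n \<Otimes>\<^sub>M noise_space n)"
  shows "(\<integral>\<^sup>+\<omega>. f (fst \<omega>) (snd \<omega>) \<partial>code_space c n) =
    (\<Sum>m\<in>{..<nmsg1 c} \<times> {..<nmsg2 c}. \<integral>\<^sup>+w. f m w \<partial>(noise_space n \<Otimes>\<^sub>M noise_space n))
      / of_nat (nmsg1 c * nmsg2 c)"
proof -
  interpret O: prob_space "noise_space n" by (rule prob_space_noise_space)
  interpret OO: pair_prob_space "noise_space n" "noise_space n" ..
  let ?M = "{..<nmsg1 c} \<times> {..<nmsg2 c}" and ?W = "noise_space n \<Otimes>\<^sub>M noise_space n"
  have "(\<integral>\<^sup>+\<omega>. f (fst \<omega>) (snd \<omega>) \<partial>code_space c n)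
      = (\<integral>\<^sup>+m. \<integral>\<^sup>+w. f m w \<partial>?W \<partial>uniform_measure (count_space UNIV) ?M)"
    using OO.P.nn_integral_fst[of "\<lambda>\<omega>. f (fst \<omega>) (snd \<omega>)" "uniform_measure (count_space UNIV) ?M"]
      code_space_measurable[of f n borel c, OF f_measurable]
    unfolding code_space_def by simp
  also have "\<dots> = (\<integral>\<^sup>+m. (\<integral>\<^sup>+w. f m w \<partial>?W) * indicator ?M m \<partial>count_space UNIV)
      / emeasure (count_space UNIV) ?M"
    by (subst nn_integral_uniform_measure) auto
  also have "(\<integral>\<^sup>+m. (\<integral>\<^sup>+w. f m w \<partial>?W) * indicator ?M m \<partial>count_space UNIV) = (\<Sum>m\<in>?M. \<integral>\<^sup>+w. f m w \<partial>?W)"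
    by (subst nn_integral_count_space_indicator[symmetric]) (auto simp: nn_integral_count_space_finite)
  also have "emeasure (count_space UNIV) ?M = of_nat (nmsg1 c * nmsg2 c)"
    by (subst emeasure_count_space_finite) (auto simp: card_cartesian_product)
  finally show ?thesis .
qed

context two_slot_code
begin

definition code :: "nat \<Rightarrow> nat \<Rightarrow> (nat \<Rightarrow> signal) \<Rightarrow> (nat \<Rightarrow> signal) \<Rightarrow> (signal \<Rightarrow> nat \<times> nat) \<Rightarrow> fbcode"
where
  "code M1 M2 c1 c2 dc = \<lparr>nmsg1 = M1, nmsg2 = M2, enc1 = (\<lambda>i m. signal1 (c1 m) i),
     enc2 = (\<lambda>i m v. signal2 (c2 m) v i), dec = dc\<rparr>"

lemma signal2_cong: "(\<And>j. j < i \<Longrightarrow> j < K \<Longrightarrow> v j = v' j) \<Longrightarrow> signal2 b v i = signal2 b v' i"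
  by (auto simp: signal2_def)

lemma signal2_causal:
  assumes "i \<le> n"
  shows "signal2 b (restrict (\<lambda>j. restrict (received a b (g, h)) {..<i} j + sqrt s * h j) {..<i}) i
    = signal2 b (feedback a b (g, h)) i"
  using assms by (intro signal2_cong) (simp add: received_first_slot block_at_def feedback_def)

lemma chan_out_code:
  "i \<le> n \<Longrightarrow> chan_out (code M1 M2 c1 c2 dc) N s m1 m2 g h i
    = restrict (received (c1 m1) (c2 m2) (g, h)) {..<i}"
proof (induction i)
  case (Suc i)
  let ?y = "received (c1 m1) (c2 m2) (g, h)"
  have "chan_out (code M1 M2 c1 c2 dc) N s m1 m2 g h (Suc i) = (restrict ?y {..<i})(i := ?y i)"
    unfolding chan_out.simps Let_def Suc.IH[OF Suc_leD[OF Suc.prems]]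
    using Suc.prems signal2_causal[of i "c2 m2" "c1 m1" g h]
    by (simp add: code_def received_def[of _ _ "(g, h)"])
  also have "\<dots> = restrict ?y {..<Suc i}"
    by (auto simp: restrict_def fun_eq_iff)
  finally show ?case .
qed (simp add: restrict_def)

lemma chan_out_code_n:
  "chan_out (code M1 M2 c1 c2 dc) N s m1 m2 g h n = received (c1 m1) (c2 m2) (g, h)"
  by (subst chan_out_code) (auto simp: received_def restrict_def fun_eq_iff)

lemma input2_code:
  "i < n \<Longrightarrow> input2 (code M1 M2 c1 c2 dc) N s m1 m2 g h i
    = signal2 (c2 m2) (feedback (c1 m1) (c2 m2) (g, h)) i"
  using signal2_causal[of i "c2 m2" "c1 m1" g h]
  by (simp add: input2_def chan_out_code) (simp add: code_def)

lemma sum_slots: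
  fixes f :: "nat \<Rightarrow> real"
  assumes "\<And>i. 2 * K \<le> i \<Longrightarrow> f i = 0"
  shows "(\<Sum>i<n. f i) = (\<Sum>k<K. f k) + (\<Sum>k<K. f (K + k))"
proof -
  have "(\<Sum>i<n. f i) = (\<Sum>i\<in>{..<K} \<union> {K..<K + K}. f i)"
    using assms by (intro sum.mono_neutral_right) auto
  also have "\<dots> = (\<Sum>k<K. f k) + (\<Sum>i\<in>{K..<K + K}. f i)"
    by (intro sum.union_disjoint) auto
  also have "(\<Sum>i\<in>{K..<K + K}. f i) = (\<Sum>k<K. f (K + k))"
    using sum.shift_bounds_nat_ivl[of f 0 K K] by (simp add: lessThan_atLeast0 add.commute)
  finally show ?thesis .
qed

lemma signal1_energy_le: "(\<Sum>i<n. (signal1 a i)\<^sup>2) \<le> pow1 * energy_budget (penalty a b w)"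
proof -
  let ?first = "(a1, 0, 0, 0, 0, 0, 0) :: block" and ?second = "(b1, d1, 0, 0, 0, 0, 0) :: block"
  have "(\<Sum>i<n. (signal1 a i)\<^sup>2) = (\<Sum>k<K. (signal1 a k)\<^sup>2) + (\<Sum>k<K. (signal1 a (K + k))\<^sup>2)"
    by (rule sum_slots) (simp add: signal1_def)
  also have "\<dots> = energy K ?first a b w + energy K ?second a b w"
    by (simp add: energy_def block_at_def signal1_def)
  also have "\<dots> \<le> (?first \<bullet> ?first) * energy_budget (penalty a b w)
      + (?second \<bullet> ?second) * energy_budget (penalty a b w)"
    by (intro add_mono energy_le_penalty) (simp_all add: upper_forms_def)
  also have "\<dots> = pow1 * energy_budget (penalty a b w)"
    by (simp add: pow1_def power2_eq_square distrib_right)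
  finally show ?thesis .
qed

lemma signal2_energy_le:
  "(\<Sum>i<n. (signal2 b (feedback a b w) i)\<^sup>2) \<le> pow2 * energy_budget (penalty a b w)"
proof -
  let ?first = "(0, 0, a2, 0, 0, 0, 0) :: block"
    and ?second = "(\<alpha> * a1, 0, b2 + \<alpha> * a2, d2, \<alpha> * sqrt N, 0, \<alpha> * sqrt s) :: block"
  let ?x = "signal2 b (feedback a b w)"
  have slots: "?x k = ?first \<bullet> block_at K a b w k" "?x (K + k) = ?second \<bullet> block_at K a b w k"
    if "k < K" for k
    using that
    by (simp_all add: block_at_def signal2_def feedback_def distrib_left distrib_right mult.assoc)
  have variance: "?second \<bullet> ?second = (\<alpha> * a1)\<^sup>2 + (b2 + \<alpha> * a2)\<^sup>2 + d2\<^sup>2 + \<alpha>\<^sup>2 * N + \<alpha>\<^sup>2 * s"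
    using noise_variances by (simp add: power2_eq_square algebra_simps)
  have "(\<Sum>i<n. (?x i)\<^sup>2) = (\<Sum>k<K. (?x k)\<^sup>2) + (\<Sum>k<K. (?x (K + k))\<^sup>2)"
    by (rule sum_slots) (simp add: signal2_def)
  also have "\<dots> = energy K ?first a b w + energy K ?second a b w"
    unfolding energy_def by (intro arg_cong2[where f = "(+)"] sum.cong refl) (simp_all add: slots)
  also have "\<dots> \<le> (?first \<bullet> ?first) * energy_budget (penalty a b w)
      + (?second \<bullet> ?second) * energy_budget (penalty a b w)"
    by (intro add_mono energy_le_penalty) (simp_all add: upper_forms_def)
  also have "\<dots> = pow2 * energy_budget (penalty a b w)"
    unfolding variance distrib_right[symmetric] by (simp add: pow2_def power2_eq_square add.assoc)
  finally show ?thesis .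
qed

definition error_bound :: "nat \<Rightarrow> nat \<Rightarrow> real" where
  "error_bound M1 M2 = 2 * penalty_bound
     + real M1 * exp (- (real K * (info1 - 2 * \<eta>))) + real M2 * exp (- (real K * (info2 - 2 * \<eta>)))
     + real (M1 * M2) * exp (- (real K * (info12 - 2 * \<eta>)))"

lemma penalty_bound_nonneg: "0 \<le> penalty_bound"
  using exponent by (simp add: penalty_bound_def chernoff_rate_def)

lemma error_bound_nonneg: "0 \<le> error_bound M1 M2"
  using penalty_bound_nonneg by (simp add: error_bound_def)

lemma mean_error_bound_eq:
  "coding.mean_error_bound M1 M2 (ennreal penalty_bound) = ennreal (error_bound M1 M2)"
  unfolding coding.mean_error_bound_def error_bound_def using penalty_bound_nonneg
  by (simp add: inv_threshold_def ennreal_mult ennreal_of_nat_eq_real_of_nat)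

end

locale two_slot_codebooks = two_slot_code +
  fixes M1 M2 :: nat and c1 c2 :: "nat \<Rightarrow> signal" and D :: real
  assumes nonempty: "1 \<le> M1" "1 \<le> M2" and D_nonneg: "0 \<le> D"
    and codewords: "c1 m \<in> space \<Omega>" "c2 m \<in> space \<Omega>"
    and sum_loss_le: "(\<Sum>m\<in>{..<M1} \<times> {..<M2}. \<integral>\<^sup>+w.
        of_bool (coding.decode M1 M2 c1 c2 (received (c1 (fst m)) (c2 (snd m)) w) \<noteq> m)
        + ennreal (penalty (c1 (fst m)) (c2 (snd m)) w) \<partial>(\<Omega> \<Otimes>\<^sub>M \<Omega>)) \<le> of_nat (M1 * M2) * ennreal D"
begin

abbreviation codebook_code :: fbcode where
  "codebook_code \<equiv> code M1 M2 c1 c2 (coding.decode M1 M2 c1 c2)"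

abbreviation \<C> :: "((nat \<times> nat) \<times> signal \<times> signal) measure" where
  "\<C> \<equiv> code_space codebook_code n"

definition message_penalty :: "nat \<times> nat \<Rightarrow> signal \<times> signal \<Rightarrow> real" where
  "message_penalty m w = penalty (c1 (fst m)) (c2 (snd m)) w"

definition loss :: "nat \<times> nat \<Rightarrow> signal \<times> signal \<Rightarrow> ennreal" where
  "loss m w = of_bool (coding.decode M1 M2 c1 c2 (received (c1 (fst m)) (c2 (snd m)) w) \<noteq> m)
     + ennreal (message_penalty m w)"

lemma message_penalty_measurable: "message_penalty m \<in> borel_measurable (\<Omega> \<Otimes>\<^sub>M \<Omega>)"
  unfolding message_penalty_def
  by (intro penalty_measurable measurable_const codewords measurable_ident_sets[OF refl])

lemma loss_measurable: "loss m \<in> borel_measurable (\<Omega> \<Otimes>\<^sub>M \<Omega>)"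
proof -
  note [measurable] = codewords coding.decode_measurable[OF codewords] message_penalty_measurable
  show ?thesis unfolding loss_def by measurable
qed

lemma nmsg_code: "nmsg1 codebook_code = M1" "nmsg2 codebook_code = M2"
  by (simp_all add: code_def)

lemma prob_space_codebook_code: "prob_space \<C>"
  using nonempty by (intro prob_space_code_space) (simp_all add: nmsg_code)

lemma nn_integral_loss_le: "(\<integral>\<^sup>+\<omega>. loss (fst \<omega>) (snd \<omega>) \<partial>\<C>) \<le> ennreal D"
proof -
  have "(\<integral>\<^sup>+\<omega>. loss (fst \<omega>) (snd \<omega>) \<partial>\<C>) \<le> of_nat (M1 * M2) * ennreal D / of_nat (M1 * M2)"
    using sum_loss_le nn_integral_code_space[of loss n codebook_code, OF loss_measurable]
    by (simp add: nmsg_code divide_right_mono_ennreal flip: loss_def message_penalty_def)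
  also have "\<dots> = ennreal D"
    using nonempty D_nonneg
    by (simp add: ennreal_of_nat_eq_real_of_nat ennreal_mult[symmetric] divide_ennreal flip: of_nat_mult)
  finally show ?thesis .
qed

lemma err_prob_le: "err_prob codebook_code N s n \<le> D"
  unfolding err_prob_def
proof (rule finite_measure.measure_le_of_indicator_le[OF _ _ nn_integral_loss_le D_nonneg])
  show "finite_measure \<C>"
    using prob_space_codebook_code by (rule prob_space.finite_measure)
  fix \<omega>
  show "indicator {\<omega> \<in> space \<C>. dec codebook_code (chan_out codebook_code N s
      (fst (fst \<omega>)) (snd (fst \<omega>)) (fst (snd \<omega>)) (snd (snd \<omega>)) n) \<noteq> fst \<omega>} \<omega> \<le> loss (fst \<omega>) (snd \<omega>)"
    unfolding chan_out_code_n by (simp add: code_def loss_def indicator_def)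
qed

lemma energy_budget_affine:
  assumes "0 \<le> p" "0 \<le> z"
  shows "ennreal (p * energy_budget z) = ennreal (p * (real K * (1 + \<eta>))) + ennreal (p / t) * ennreal z"
  using assms exponent slack
  by (simp add: energy_budget_def ennreal_mult[symmetric] distrib_left flip: ennreal_plus)

lemma nn_integral_energy_budget_le:
  assumes "0 \<le> p"
  shows "(\<integral>\<^sup>+\<omega>. ennreal (p * energy_budget (message_penalty (fst \<omega>) (snd \<omega>))) \<partial>\<C>)
    \<le> ennreal (p * energy_budget D)"
proof -
  interpret C: prob_space \<C> by (rule prob_space_codebook_code)
  let ?q = "\<lambda>\<omega>. message_penalty (fst \<omega>) (snd \<omega>)"
  have [measurable]: "(\<lambda>\<omega>. ennreal (?q \<omega>)) \<in> borel_measurable \<C>"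
    by (intro measurable_compose[OF _ measurable_ennreal] code_space_measurable message_penalty_measurable)
  have nonneg: "0 \<le> ?q \<omega>" for \<omega>
    by (simp add: message_penalty_def penalty_nonneg)
  have "(\<integral>\<^sup>+\<omega>. ennreal (p * energy_budget (?q \<omega>)) \<partial>\<C>)
      = ennreal (p * (real K * (1 + \<eta>))) + ennreal (p / t) * (\<integral>\<^sup>+\<omega>. ennreal (?q \<omega>) \<partial>\<C>)"
    unfolding energy_budget_affine[OF assms nonneg]
    by (simp add: nn_integral_add nn_integral_cmult C.emeasure_space_1)
  also have "\<dots> \<le> ennreal (p * (real K * (1 + \<eta>))) + ennreal (p / t) * ennreal D"
  proof (intro add_left_mono mult_left_mono)
    have "(\<integral>\<^sup>+\<omega>. ennreal (?q \<omega>) \<partial>\<C>) \<le> (\<integral>\<^sup>+\<omega>. loss (fst \<omega>) (snd \<omega>) \<partial>\<C>)"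
      unfolding loss_def by (intro nn_integral_mono) simp
    also note nn_integral_loss_le
    finally show "(\<integral>\<^sup>+\<omega>. ennreal (?q \<omega>) \<partial>\<C>) \<le> ennreal D" .
  qed simp
  also have "\<dots> = ennreal (p * energy_budget D)"
    by (rule energy_budget_affine[OF assms D_nonneg, symmetric])
  finally show ?thesis .
qed

lemma enc2_measurable:
  assumes "i < n"
  shows "enc2 codebook_code i m \<in> borel_measurable (PiM {..<i} (\<lambda>_. borel))"
proof (cases "i < K \<or> \<not> i < 2 * K")
  case True
  then show ?thesis by (auto simp: code_def signal2_def)
next
  case False
  then have "i - K \<in> {..<i}" by auto
  then show ?thesis
    using False by (auto simp: code_def signal2_def intro!: measurable_component_singleton)
qed

lemma nn_integral_enc1_le:
  assumes "pow1 * energy_budget D \<le> real n * P1"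
  shows "(\<Sum>i<n. \<integral>\<^sup>+\<omega>. ennreal ((enc1 codebook_code i (fst (fst \<omega>)))\<^sup>2) \<partial>\<C>) \<le> ennreal (real n * P1)"
proof -
  have "(\<Sum>i<n. \<integral>\<^sup>+\<omega>. ennreal ((enc1 codebook_code i (fst (fst \<omega>)))\<^sup>2) \<partial>\<C>)
      = (\<integral>\<^sup>+\<omega>. (\<Sum>i<n. ennreal ((enc1 codebook_code i (fst (fst \<omega>)))\<^sup>2)) \<partial>\<C>)"
    by (intro nn_integral_sum[symmetric]
      code_space_measurable[where f = "\<lambda>m w. ennreal ((enc1 codebook_code _ (fst m))\<^sup>2)"]) simp
  also have "\<dots> \<le> (\<integral>\<^sup>+\<omega>. ennreal (pow1 * energy_budget (message_penalty (fst \<omega>) (snd \<omega>))) \<partial>\<C>)"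
    by (intro nn_integral_mono)
      (simp add: code_def message_penalty_def sum_ennreal signal1_energy_le ennreal_leI)
  also note nn_integral_energy_budget_le[OF pow_nonneg(1)]
  also have "ennreal (pow1 * energy_budget D) \<le> ennreal (real n * P1)"
    using assms by (rule ennreal_leI)
  finally show ?thesis .
qed

lemma nn_integral_input2_le:
  assumes "pow2 * energy_budget D \<le> real n * P2"
  shows "(\<Sum>i<n. \<integral>\<^sup>+\<omega>. ennreal ((input2 codebook_code N s (fst (fst \<omega>)) (snd (fst \<omega>))
    (fst (snd \<omega>)) (snd (snd \<omega>)) i)\<^sup>2) \<partial>\<C>) \<le> ennreal (real n * P2)"
proof -
  let ?x = "\<lambda>i m w. signal2 (c2 (snd m)) (feedback (c1 (fst m)) (c2 (snd m)) w) i"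
  have x_measurable: "(\<lambda>w. ennreal ((?x i m w)\<^sup>2)) \<in> borel_measurable (\<Omega> \<Otimes>\<^sub>M \<Omega>)" if "i < n" for i m
    using codewords[measurable] signal2_measurable[OF that, measurable] by measurable
  have "(\<Sum>i<n. \<integral>\<^sup>+\<omega>. ennreal ((input2 codebook_code N s (fst (fst \<omega>)) (snd (fst \<omega>))
        (fst (snd \<omega>)) (snd (snd \<omega>)) i)\<^sup>2) \<partial>\<C>)
      = (\<Sum>i<n. \<integral>\<^sup>+\<omega>. ennreal ((?x i (fst \<omega>) (snd \<omega>))\<^sup>2) \<partial>\<C>)"
    by (simp add: input2_code)
  also have "\<dots> = (\<integral>\<^sup>+\<omega>. (\<Sum>i<n. ennreal ((?x i (fst \<omega>) (snd \<omega>))\<^sup>2)) \<partial>\<C>)"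
    by (intro nn_integral_sum[symmetric]
      code_space_measurable[where f = "\<lambda>m w. ennreal ((?x _ m w)\<^sup>2)"] x_measurable) simp
  also have "\<dots> \<le> (\<integral>\<^sup>+\<omega>. ennreal (pow2 * energy_budget (message_penalty (fst \<omega>) (snd \<omega>))) \<partial>\<C>)"
    by (intro nn_integral_mono) (simp add: message_penalty_def sum_ennreal signal2_energy_le ennreal_leI)
  also note nn_integral_energy_budget_le[OF pow_nonneg(2)]
  also have "ennreal (pow2 * energy_budget D) \<le> ennreal (real n * P2)"
    using assms by (rule ennreal_leI)
  finally show ?thesis .
qed

lemma valid_codebook_code:
  assumes "pow1 * energy_budget D \<le> real n * P1" "pow2 * energy_budget D \<le> real n * P2"
  shows "valid_code codebook_code n P1 P2 N s"
  unfolding valid_code_def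
  using nonempty coding.decode_measurable[OF codewords] enc2_measurable
    nn_integral_enc1_le[OF assms(1)] nn_integral_input2_le[OF assms(2)]
  by (simp add: nmsg_code) (simp add: code_def)

end

lemma (in two_slot_code) exists_code:
  assumes nonempty: "1 \<le> M1" "1 \<le> M2" and bound_less: "error_bound M1 M2 < D"
    and powers: "pow1 * energy_budget D \<le> real n * P1" "pow2 * energy_budget D \<le> real n * P2"
  obtains c where "valid_code c n P1 P2 N s" "nmsg1 c = M1" "nmsg2 c = M2" "err_prob c N s n \<le> D"
proof -
  have "0 < D" using bound_less error_bound_nonneg[of M1 M2] by linarith
  then have "coding.mean_error_bound M1 M2 (ennreal penalty_bound) < ennreal D"
    unfolding mean_error_bound_eq using bound_less by (intro ennreal_lessI)
  from coding.exists_codebooks[OF nn_integral_penalty nonempty this] obtain c1 c2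
    where codebooks: "\<And>m. c1 m \<in> space \<Omega>" "\<And>m. c2 m \<in> space \<Omega>"
      "(\<Sum>m\<in>{..<M1} \<times> {..<M2}. \<integral>\<^sup>+w.
        of_bool (coding.decode M1 M2 c1 c2 (received (c1 (fst m)) (c2 (snd m)) w) \<noteq> m)
        + ennreal (penalty (c1 (fst m)) (c2 (snd m)) w) \<partial>(\<Omega> \<Otimes>\<^sub>M \<Omega>)) \<le> of_nat (M1 * M2) * ennreal D"
    by blast
  interpret two_slot_codebooks N s a1 a2 d1 d2 \<kappa> \<alpha> \<eta> t n M1 M2 c1 c2 D
    using nonempty codebooks \<open>0 < D\<close> by unfold_locales auto
  show thesis
    by (rule that[OF valid_codebook_code[OF powers] nmsg_code err_prob_le])
qed

section \<open>Achievable rates\<close>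

definition good_code :: "real \<Rightarrow> real \<Rightarrow> real \<Rightarrow> real \<Rightarrow> real \<Rightarrow> real \<Rightarrow> real \<Rightarrow> nat \<Rightarrow> fbcode \<Rightarrow> bool" where
  "good_code P1 P2 N s r1 r2 \<epsilon> n c \<longleftrightarrow> valid_code c n P1 P2 N s \<and>
     exp (real n * r1) \<le> real (nmsg1 c) \<and> exp (real n * r2) \<le> real (nmsg2 c) \<and>
     err_prob c N s n \<le> \<epsilon>"

lemma rate_less_ln_div:
  assumes "0 < \<delta>" "0 < n" and "exp (real n * r) \<le> M"
  shows "r - \<delta> < ln M / real n"
proof -
  have "0 < M" using assms(3) exp_gt_zero[of "real n * r"] by linarith
  then have "real n * r \<le> ln M" using assms(3) by (simp add: ln_ge_iff)
  then have "r \<le> ln M / real n" using assms(2) by (simp add: field_simps)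
  then show ?thesis using assms(1) by simp
qed

lemma achievable_fbI:
  assumes vanishing: "\<epsilon> \<longlonglongrightarrow> 0"
    and codes_exist: "\<forall>\<^sub>F n in sequentially. \<exists>c. good_code P1 P2 N s r1 r2 (\<epsilon> n) n c"
  shows "achievable_fb P1 P2 N s r1 r2"
proof -
  define C where "C n = (SOME c. good_code P1 P2 N s r1 r2 (\<epsilon> n) n c)" for n
  have good: "\<forall>\<^sub>F n in sequentially. good_code P1 P2 N s r1 r2 (\<epsilon> n) n (C n)"
    using codes_exist unfolding C_def by eventually_elim (rule someI_ex)
  show ?thesis
    unfolding achievable_fb_def
  proof (intro allI impI exI[of _ C] conjI)
    fix \<delta> :: real assume "0 < \<delta>"
    show "\<forall>\<^sub>F n in sequentially. valid_code (C n) n P1 P2 N s \<and>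
        r1 - \<delta> < ln (real (nmsg1 (C n))) / real n \<and> r2 - \<delta> < ln (real (nmsg2 (C n))) / real n"
      using good eventually_gt_at_top[of 0]
      by eventually_elim (use \<open>0 < \<delta>\<close> in \<open>auto simp: good_code_def intro: rate_less_ln_div\<close>)
    show "(\<lambda>n. err_prob (C n) N s n) \<longlonglongrightarrow> 0"
    proof (rule tendsto_sandwich[OF _ _ tendsto_const vanishing])
      show "\<forall>\<^sub>F n in sequentially. 0 \<le> err_prob (C n) N s n" by (simp add: err_prob_def)
      show "\<forall>\<^sub>F n in sequentially. err_prob (C n) N s n \<le> \<epsilon> n"
        using good by eventually_elim (simp add: good_code_def)
    qed
  qed
qed

lemma achievable_fb_closed:
  assumes "\<And>\<delta>. 0 < \<delta> \<Longrightarrow> \<exists>r1 r2. R1 - \<delta> < r1 \<and> R2 - \<delta> < r2 \<and> achievable_fb P1 P2 N s r1 r2"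
  shows "achievable_fb P1 P2 N s R1 R2"
  unfolding achievable_fb_def
proof (intro allI impI)
  fix \<delta> :: real assume "0 < \<delta>"
  then have half_pos: "0 < \<delta> / 2" by simp
  from assms[OF half_pos] obtain r1 r2
    where close: "R1 - \<delta> / 2 < r1" "R2 - \<delta> / 2 < r2" and "achievable_fb P1 P2 N s r1 r2"
    by blast
  then obtain C where codes: "\<forall>\<^sub>F n in sequentially. valid_code (C n) n P1 P2 N s \<and>
      ln (real (nmsg1 (C n))) / real n > r1 - \<delta> / 2 \<and> ln (real (nmsg2 (C n))) / real n > r2 - \<delta> / 2"
    and err: "(\<lambda>n. err_prob (C n) N s n) \<longlonglongrightarrow> 0"
    using half_pos unfolding achievable_fb_def by blast
  have "\<forall>\<^sub>F n in sequentially. valid_code (C n) n P1 P2 N s \<and>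
      ln (real (nmsg1 (C n))) / real n > R1 - \<delta> \<and> ln (real (nmsg2 (C n))) / real n > R2 - \<delta>"
    using codes by eventually_elim (use close in auto)
  with err show "\<exists>C. (\<forall>\<^sub>F n in sequentially. valid_code (C n) n P1 P2 N s \<and>
      ln (real (nmsg1 (C n))) / real n > R1 - \<delta> \<and> ln (real (nmsg2 (C n))) / real n > R2 - \<delta>)
      \<and> (\<lambda>n. err_prob (C n) N s n) \<longlonglongrightarrow> 0"
    by blast
qed

lemma filterlim_div_2: "filterlim (\<lambda>n::nat. n div 2) at_top sequentially"
  unfolding filterlim_at_top
proof
  fix Z :: nat
  show "\<forall>\<^sub>F n in sequentially. Z \<le> n div 2"
    using eventually_ge_at_top[of "2 * Z"] by eventually_elim auto
qed

lemma tendsto_power_div_2: "\<bar>x\<bar> < 1 \<Longrightarrow> (\<lambda>n. x ^ (n div 2)) \<longlonglongrightarrow> (0::real)"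
  by (rule filterlim_compose[OF LIMSEQ_power_zero filterlim_div_2]) simp

lemma tendsto_exp_growth_mult_exp_div_2:
  fixes f :: "nat \<Rightarrow> real"
  assumes nonneg: "\<And>n. 0 \<le> f n" and growth: "\<And>n. f n \<le> C * exp (real n * r)"
    and rate: "0 \<le> r" "2 * r < g"
  shows "(\<lambda>n. f n * exp (- (real (n div 2) * g))) \<longlonglongrightarrow> 0"
proof (rule tendsto_sandwich[OF _ _ tendsto_const])
  have "0 \<le> C" using nonneg[of 0] growth[of 0] by simp
  have "f n * exp (- (real (n div 2) * g)) \<le> C * exp r * exp (2 * r - g) ^ (n div 2)" for n
  proof -
    have "real n * r \<le> (2 * real (n div 2) + 1) * r" using rate(1) by (intro mult_right_mono) linarith+
    then have "C * exp (real n * r) \<le> C * exp (r + real (n div 2) * (2 * r))"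
      using \<open>0 \<le> C\<close> by (intro mult_left_mono) (simp_all add: algebra_simps)
    with growth[of n] have "f n * exp (- (real (n div 2) * g))
        \<le> C * exp (r + real (n div 2) * (2 * r)) * exp (- (real (n div 2) * g))"
      by (intro mult_right_mono) auto
    also have "\<dots> = C * exp r * exp (2 * r - g) ^ (n div 2)"
      by (simp add: exp_add[symmetric] exp_of_nat_mult[symmetric] algebra_simps)
    finally show ?thesis .
  qed
  then show "\<forall>\<^sub>F n in sequentially.
      f n * exp (- (real (n div 2) * g)) \<le> C * exp r * exp (2 * r - g) ^ (n div 2)"
    by simp
  show "(\<lambda>n. C * exp r * exp (2 * r - g) ^ (n div 2)) \<longlonglongrightarrow> 0"
    using rate(2) by (intro tendsto_mult_right_zero tendsto_power_div_2) simp
qed (use nonneg in simp)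

lemma eventually_block_energy_le:
  fixes p P \<eta> t :: real
  assumes power: "0 \<le> p" "p * (1 + \<eta>) < 2 * P" and "0 < \<eta>" "0 < t" and vanishing: "\<epsilon> \<longlonglongrightarrow> 0"
  shows "\<forall>\<^sub>F n in sequentially. p * (real (n div 2) * (1 + \<eta>) + \<epsilon> n / t) \<le> real n * P"
proof -
  define gap where "gap = 2 * P - p * (1 + \<eta>)"
  have "0 \<le> p * (1 + \<eta>)" using power(1) \<open>0 < \<eta>\<close> by simp
  then have "0 < gap" "0 < P" using power(2) by (simp_all add: gap_def)
  have "filterlim (\<lambda>n. real (n div 2)) at_top sequentially"
    by (rule filterlim_compose[OF filterlim_real_sequentially filterlim_div_2])
  then have "\<forall>\<^sub>F n in sequentially. p / t / gap \<le> real (n div 2)"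
    by (simp add: filterlim_at_top)
  moreover have "\<forall>\<^sub>F n in sequentially. \<epsilon> n < 1"
    using vanishing by (rule order_tendstoD) simp
  ultimately show ?thesis
  proof eventually_elim
    case (elim n)
    have "p * (\<epsilon> n / t) \<le> p / t"
      using elim(2) power(1) \<open>0 < t\<close> by (simp add: divide_right_mono mult_left_le)
    also have "\<dots> \<le> gap * real (n div 2)"
      using elim(1) \<open>0 < gap\<close> by (simp only: pos_divide_le_eq mult.commute)
    finally have "p * (real (n div 2) * (1 + \<eta>) + \<epsilon> n / t) \<le> 2 * real (n div 2) * P"
      by (simp add: gap_def algebra_simps)
    also have "\<dots> \<le> real n * P" using \<open>0 < P\<close> by (intro mult_right_mono) linarith+
    finally show ?case .
  qed
qed

lemma exists_chernoff_exponent: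
  assumes "0 < \<eta>"
  obtains t where "0 < t" "t < 1/2" "chernoff_rate t (1 + \<eta>) < 1" "chernoff_rate (- t) (1 - \<eta>) < 1"
proof -
  define t where "t = min (1/4) (\<eta> / 8)"
  have small: "0 < t" "t \<le> 1/4" "4 * t < \<eta>" using assms by (auto simp: t_def)
  then have "4 * t\<^sup>2 < t * \<eta>" by (simp add: power2_eq_square)
  with small show thesis by (intro that[of t] chernoff_rate_less_1) auto
qed

definition message_count :: "real \<Rightarrow> nat \<Rightarrow> nat" where
  "message_count r n = nat \<lceil>exp (real n * r)\<rceil>"

lemma message_count_bounds:
  assumes "0 \<le> r"
  shows "exp (real n * r) \<le> real (message_count r n)" "real (message_count r n) \<le> 2 * exp (real n * r)"
    and "1 \<le> message_count r n"
proof -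
  have "1 \<le> exp (real n * r)" using assms by simp
  then show "exp (real n * r) \<le> real (message_count r n)"
    "real (message_count r n) \<le> 2 * exp (real n * r)" "1 \<le> message_count r n"
    unfolding message_count_def by linarith+
qed

context two_slot_scheme
begin

lemma exists_typicality_slack:
  assumes "2 * r1 < info1" "2 * r2 < info2" "2 * (r1 + r2) < info12" "pow1 < 2 * P1" "pow2 < 2 * P2"
  obtains \<eta> where "0 < \<eta>" "2 * r1 < info1 - 2 * \<eta>" "2 * r2 < info2 - 2 * \<eta>"
    "2 * (r1 + r2) < info12 - 2 * \<eta>" "pow1 * (1 + \<eta>) < 2 * P1" "pow2 * (1 + \<eta>) < 2 * P2"
proof -
  have info: "\<forall>\<^sub>F \<eta> in at_right 0. r < I - 2 * \<eta>" if "r < I" for r I :: real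
    using that by (intro order_tendstoD(1)[where y = "I - 2 * 0"] tendsto_intros) auto
  have pow: "\<forall>\<^sub>F \<eta> in at_right 0. p * (1 + \<eta>) < P" if "p < P" for p P :: real
    using that by (intro order_tendstoD(2)[where y = "p * (1 + 0)"] tendsto_intros) auto
  have "\<forall>\<^sub>F \<eta> in at_right 0. 0 < \<eta> \<and> 2 * r1 < info1 - 2 * \<eta> \<and> 2 * r2 < info2 - 2 * \<eta> \<and>
      2 * (r1 + r2) < info12 - 2 * \<eta> \<and> pow1 * (1 + \<eta>) < 2 * P1 \<and> pow2 * (1 + \<eta>) < 2 * P2"
    by (intro eventually_conj eventually_at_right_less info pow assms)
  then show thesis
    using that eventually_happens'[OF trivial_limit_at_right_real] by blast
qed

lemma tendsto_error_bound:
  assumes code: "two_slot_code N s a1 a2 d1 d2 \<eta> t"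
    and nonneg: "0 \<le> r1" "0 \<le> r2"
    and rates: "2 * r1 < info1 - 2 * \<eta>" "2 * r2 < info2 - 2 * \<eta>" "2 * (r1 + r2) < info12 - 2 * \<eta>"
    and chernoff: "chernoff_rate t (1 + \<eta>) < 1" "chernoff_rate (- t) (1 - \<eta>) < 1"
  shows "(\<lambda>n. two_slot_code.error_bound N s a1 a2 d1 d2 \<kappa> \<alpha> \<eta> t n
    (message_count r1 n) (message_count r2 n)) \<longlonglongrightarrow> 0"
proof -
  have "0 < t" "t < 1/2" using two_slot_code.exponent[OF code] by auto
  then have decay: "\<bar>chernoff_rate t (1 + \<eta>)\<bar> < 1" "\<bar>chernoff_rate (- t) (1 - \<eta>)\<bar> < 1"
    using chernoff by (simp_all add: chernoff_rate_def)
  have pairs: "real (message_count r1 n * message_count r2 n) \<le> 4 * exp (real n * (r1 + r2))" for n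
  proof -
    have "real (message_count r1 n * message_count r2 n)
        \<le> (2 * exp (real n * r1)) * (2 * exp (real n * r2))"
      unfolding of_nat_mult using nonneg by (intro mult_mono message_count_bounds) auto
    then show ?thesis by (simp add: exp_add distrib_left)
  qed
  have "(\<lambda>n. two_slot_code.error_bound N s a1 a2 d1 d2 \<kappa> \<alpha> \<eta> t n
      (message_count r1 n) (message_count r2 n)) \<longlonglongrightarrow> 2 * (6 * 0 + 6 * 0) + 0 + 0 + 0"
    unfolding two_slot_code.error_bound_def[OF code] two_slot_code.penalty_bound_def[OF code]
    using nonneg rates by (intro tendsto_add tendsto_mult_left tendsto_power_div_2 decay
      tendsto_exp_growth_mult_exp_div_2[OF _ message_count_bounds(2)]
      tendsto_exp_growth_mult_exp_div_2[OF _ pairs]) simp_all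
  then show ?thesis by simp
qed

theorem achievable:
  assumes nonneg: "0 \<le> r1" "0 \<le> r2"
    and rates: "2 * r1 < info1" "2 * r2 < info2" "2 * (r1 + r2) < info12"
    and powers: "pow1 < 2 * P1" "pow2 < 2 * P2"
  shows "achievable_fb P1 P2 N s r1 r2"
proof -
  obtain \<eta> where "0 < \<eta>" and rates_slack: "2 * r1 < info1 - 2 * \<eta>" "2 * r2 < info2 - 2 * \<eta>"
      "2 * (r1 + r2) < info12 - 2 * \<eta>"
    and power_slack: "pow1 * (1 + \<eta>) < 2 * P1" "pow2 * (1 + \<eta>) < 2 * P2"
    using exists_typicality_slack[OF rates powers] by blast
  obtain t where t_bounds: "0 < t" "t < 1/2"
    and chernoff: "chernoff_rate t (1 + \<eta>) < 1" "chernoff_rate (- t) (1 - \<eta>) < 1"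
    using exists_chernoff_exponent[OF \<open>0 < \<eta>\<close>] by blast
  have code: "two_slot_code N s a1 a2 d1 d2 \<eta> t"
    using \<open>0 < \<eta>\<close> t_bounds two_slot_scheme_axioms
    by (simp add: two_slot_code_def two_slot_code_axioms_def)
  let ?M1 = "message_count r1" and ?M2 = "message_count r2"
  define \<epsilon> where "\<epsilon> n =
    two_slot_code.error_bound N s a1 a2 d1 d2 \<kappa> \<alpha> \<eta> t n (?M1 n) (?M2 n) + 1 / real (Suc n)" for n
  have vanishing: "\<epsilon> \<longlonglongrightarrow> 0"
    unfolding \<epsilon>_def
    using tendsto_add[OF tendsto_error_bound[OF code nonneg rates_slack chernoff]
      LIMSEQ_Suc[OF lim_1_over_n]] by simp
  note energy_le = eventually_block_energy_le[OF _ _ \<open>0 < \<eta>\<close> t_bounds(1) vanishing]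
  show ?thesis
  proof (rule achievable_fbI[OF vanishing])
    show "\<forall>\<^sub>F n in sequentially. \<exists>c. good_code P1 P2 N s r1 r2 (\<epsilon> n) n c"
      using energy_le[OF pow_nonneg(1) power_slack(1)] energy_le[OF pow_nonneg(2) power_slack(2)]
    proof eventually_elim
      case (elim n)
      interpret two_slot_code N s a1 a2 d1 d2 \<kappa> \<alpha> \<eta> t n by (rule code)
      have "error_bound (?M1 n) (?M2 n) < \<epsilon> n" by (simp add: \<epsilon>_def)
      with message_count_bounds(3)[OF nonneg(1)] message_count_bounds(3)[OF nonneg(2)]
      obtain c where "valid_code c n P1 P2 N s" "nmsg1 c = ?M1 n" "nmsg2 c = ?M2 n"
          "err_prob c N s n \<le> \<epsilon> n"
        using exists_code elim[folded energy_budget_def] by blast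
      then show ?case
        using message_count_bounds(1)[OF nonneg(1)] message_count_bounds(1)[OF nonneg(2)]
        by (auto simp: good_code_def)
    qed
  qed
qed

end

section \<open>Comparison with the capacity region without feedback\<close>

lemma C_MAC_iff:
  "(R1, R2) \<in> C_MAC P1 P2 N \<longleftrightarrow> 0 \<le> R1 \<and> 0 \<le> R2 \<and> R1 \<le> gauss_capacity (P1 / N) \<and>
    R2 \<le> gauss_capacity (P2 / N) \<and> R1 + R2 \<le> gauss_capacity ((P1 + P2) / N)"
  by (simp add: C_MAC_def gauss_capacity_def)

lemma gauss_capacity_pos: "0 < x \<Longrightarrow> 0 < gauss_capacity x"
  by (simp add: gauss_capacity_def)

lemma gauss_capacity_less: "0 \<le> x \<Longrightarrow> x < y \<Longrightarrow> gauss_capacity x < gauss_capacity y"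
  by (simp add: gauss_capacity_def)

lemma mult_gauss_capacity_le:
  assumes "0 \<le> c" "c \<le> 1" "0 \<le> x"
  shows "c * gauss_capacity x \<le> gauss_capacity (c * x)"
proof -
  have "(1 - c) * ln 1 + c * ln (1 + x) \<le> ln ((1 - c) * 1 + c * (1 + x))"
    using assms concave_onD[OF ln_concave, of c 1 "1 + x"] by simp
  then show ?thesis by (simp add: gauss_capacity_def algebra_simps)
qed

lemma gauss_capacity_add_less:
  assumes "0 < x" "0 < y"
  shows "gauss_capacity (x + y) < gauss_capacity x + gauss_capacity y"
proof -
  have "1 + (x + y) < (1 + x) * (1 + y)" using assms by (simp add: algebra_simps)
  then have "ln (1 + (x + y)) < ln ((1 + x) * (1 + y))"
    using assms by (subst ln_less_cancel_iff) (auto simp: add_pos_pos)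
  also have "\<dots> = ln (1 + x) + ln (1 + y)" using assms by (simp add: ln_mult)
  finally show ?thesis by (simp add: gauss_capacity_def)
qed

lemma achievable_fb_reduced_rates:
  assumes params: "0 < P1" "0 < P2" "0 < N" "0 \<le> s" and in_C_MAC: "(R1, R2) \<in> C_MAC P1 P2 N"
    and c: "0 < c" "c < 1"
  shows "achievable_fb P1 P2 N s (c\<^sup>2 * R1) (c\<^sup>2 * R2)"
proof -
  interpret two_slot_scheme N s "sqrt (c * P1)" "sqrt (c * P2)" "sqrt (c * P1)" "sqrt (c * P2)" 0 0
    using params c by unfold_locales auto
  have reduced: "c\<^sup>2 * R < gauss_capacity (c * x)" if "R \<le> gauss_capacity x" "0 < x" for R x
  proof -
    have "c\<^sup>2 * R \<le> c\<^sup>2 * gauss_capacity x" using that by (intro mult_left_mono) auto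
    also have "\<dots> < c * gauss_capacity x"
      using c gauss_capacity_pos[OF that(2)] by (simp add: power2_eq_square)
    also have "\<dots> \<le> gauss_capacity (c * x)" using c that by (intro mult_gauss_capacity_le) auto
    finally show ?thesis .
  qed
  have "0 \<le> R1" "0 \<le> R2" and "c\<^sup>2 * R1 < gauss_capacity (c * (P1 / N))"
    "c\<^sup>2 * R2 < gauss_capacity (c * (P2 / N))"
    "c\<^sup>2 * (R1 + R2) < gauss_capacity (c * ((P1 + P2) / N))"
    using in_C_MAC params
      reduced[of R1 "P1 / N"] reduced[of R2 "P2 / N"] reduced[of "R1 + R2" "(P1 + P2) / N"]
    by (simp_all add: C_MAC_iff)
  then show ?thesis
    using params c by (intro achievable)
      (simp_all add: info1_def info2_def info12_def pow1_def pow2_def N'_def distrib_left[symmetric])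
qed

lemma C_MAC_subset:
  assumes params: "0 < P1" "0 < P2" "0 < N" "0 \<le> s"
  shows "C_MAC P1 P2 N \<subseteq> C_NoisyPartialFB P1 P2 N s"
proof clarify
  fix R1 R2 assume in_C_MAC: "(R1, R2) \<in> C_MAC P1 P2 N"
  have "achievable_fb P1 P2 N s R1 R2"
  proof (rule achievable_fb_closed)
    fix \<delta> :: real assume "0 < \<delta>"
    have near: "\<forall>\<^sub>F c in at_left 1. r - \<delta> < c\<^sup>2 * r" for r :: real
      using \<open>0 < \<delta>\<close> by (intro order_tendstoD(1)[where y = "1\<^sup>2 * r"] tendsto_intros) auto
    have "\<forall>\<^sub>F c in at_left (1::real). c \<in> {0<..<1}"
      by (rule eventually_at_left_real) simp
    with near[of R1] near[of R2]
    have "\<forall>\<^sub>F c in at_left 1. R1 - \<delta> < c\<^sup>2 * R1 \<and> R2 - \<delta> < c\<^sup>2 * R2 \<and> c \<in> {0<..<1}"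
      by eventually_elim simp
    then obtain c where "R1 - \<delta> < c\<^sup>2 * R1" "R2 - \<delta> < c\<^sup>2 * R2" "c \<in> {0<..<1}"
      using eventually_happens'[OF trivial_limit_at_left_real] by blast
    then show "\<exists>r1 r2. R1 - \<delta> < r1 \<and> R2 - \<delta> < r2 \<and> achievable_fb P1 P2 N s r1 r2"
      using achievable_fb_reduced_rates[OF params in_C_MAC, of c] by auto
  qed
  then show "(R1, R2) \<in> C_NoisyPartialFB P1 P2 N s"
    using in_C_MAC by (simp add: C_NoisyPartialFB_def C_MAC_iff)
qed

lemma exists_rate_pair:
  fixes i1 i2 i12 L :: real
  assumes i_pos: "0 < i1" "0 < i2" and L_bounds: "0 \<le> L" "L < i1 + i2" "L < i12"
  obtains r1 r2 where "0 \<le> r1" "0 \<le> r2" "2 * r1 < i1" "2 * r2 < i2" "2 * (r1 + r2) < i12"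
    "L < 2 * (r1 + r2)"
proof -
  obtain T where T_bounds: "L < T" "T < i1 + i2" "T < i12"
    using dense[of L "min (i1 + i2) i12"] L_bounds by auto
  define q where "q = T / (i1 + i2)"
  have q_bounds: "0 \<le> q" "q < 1" and q_mult: "q * (i1 + i2) = T"
    using T_bounds L_bounds i_pos by (simp_all add: q_def)
  show thesis
  proof (rule that[of "q * i1 / 2" "q * i2 / 2"])
    have "2 * (q * i1 / 2 + q * i2 / 2) = T" using q_mult by (simp add: distrib_left)
    with T_bounds show "2 * (q * i1 / 2 + q * i2 / 2) < i12" "L < 2 * (q * i1 / 2 + q * i2 / 2)"
      by auto
  qed (use q_bounds i_pos in auto)
qed

text \<open>With correlation \<open>\<theta>\<close> between the slots, transmitter 2 saves energy of order \<open>\<theta>\<^sup>3\<close> by adding \<open>\<theta>\<^sup>2\<close>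
  times its feedback, while the noise that this adds costs only order \<open>\<theta>\<^sup>4\<close>. The variances
  \<open>fresh1 P1 P2 \<theta>\<close> and \<open>fresh2 P1 P2 N s \<theta>\<close> of the fresh symbols use up the power budget except for \<open>\<theta>\<^sup>4\<close>.\<close>

definition fresh1 :: "real \<Rightarrow> real \<Rightarrow> real \<Rightarrow> real" where
  "fresh1 P1 P2 \<theta> = P1 - \<theta>\<^sup>2 * P2 - \<theta> ^ 4"

definition fresh2 :: "real \<Rightarrow> real \<Rightarrow> real \<Rightarrow> real \<Rightarrow> real \<Rightarrow> real" where
  "fresh2 P1 P2 N s \<theta> = P2 - \<theta>\<^sup>2 * P1 + 2 * \<theta> ^ 3 * sqrt (P1 * P2) - \<theta> ^ 4 * (P1 + P2 + N + s + 1)"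

definition slot2_noise :: "real \<Rightarrow> real \<Rightarrow> real \<Rightarrow> real" where
  "slot2_noise N s \<theta> = N + \<theta> ^ 4 * s"

lemma tendsto_gauss_capacity_slot2:
  assumes "(f \<longlongrightarrow> P) (at_right 0)" "0 < P" "0 < N"
  shows "((\<lambda>\<theta>. gauss_capacity (f \<theta> / slot2_noise N s \<theta>)) \<longlongrightarrow> gauss_capacity (P / N)) (at_right 0)"
proof -
  have "((\<lambda>\<theta>. f \<theta> / (N + \<theta> ^ 4 * s)) \<longlongrightarrow> P / (N + 0 ^ 4 * s)) (at_right 0)"
    using assms(3) by (intro tendsto_intros assms(1)) auto
  then have ratio: "((\<lambda>\<theta>. f \<theta> / (N + \<theta> ^ 4 * s)) \<longlongrightarrow> P / N) (at_right 0)" by simp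
  have "1 + P / N \<noteq> 0" using assms by (simp add: add_pos_pos less_imp_neq[symmetric])
  then show ?thesis
    unfolding gauss_capacity_def slot2_noise_def
    by (intro tendsto_divide tendsto_ln tendsto_add[OF _ ratio] tendsto_const) auto
qed

lemma exists_small_correlation:
  assumes params: "0 < P1" "0 < P2" "0 < N" "0 \<le> s"
  obtains \<theta> where "0 < \<theta>" "0 < fresh1 P1 P2 \<theta>" "0 < fresh2 P1 P2 N s \<theta>"
    "\<theta> * ((P1 + P2 + N) * s + N * (P1 + P2 + N + 2)) < 2 * N * sqrt (P1 * P2)"
    "2 * gauss_capacity ((P1 + P2) / N)
      < gauss_capacity (P1 / N) + gauss_capacity (fresh1 P1 P2 \<theta> / slot2_noise N s \<theta>)
        + (gauss_capacity (P2 / N) + gauss_capacity (fresh2 P1 P2 N s \<theta> / slot2_noise N s \<theta>))"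
proof -
  let ?at0 = "at_right (0::real)"
  let ?c = "(P1 + P2 + N) * s + N * (P1 + P2 + N + 2)"
  let ?sum = "\<lambda>\<theta>. gauss_capacity (P1 / N) + gauss_capacity (fresh1 P1 P2 \<theta> / slot2_noise N s \<theta>)
    + (gauss_capacity (P2 / N) + gauss_capacity (fresh2 P1 P2 N s \<theta> / slot2_noise N s \<theta>))"
  have "(fresh1 P1 P2 \<longlongrightarrow> P1 - 0\<^sup>2 * P2 - 0 ^ 4) ?at0"
    unfolding fresh1_def by (intro tendsto_intros)
  then have fresh1: "(fresh1 P1 P2 \<longlongrightarrow> P1) ?at0" by simp
  have "(fresh2 P1 P2 N s
      \<longlongrightarrow> P2 - 0\<^sup>2 * P1 + 2 * 0 ^ 3 * sqrt (P1 * P2) - 0 ^ 4 * (P1 + P2 + N + s + 1)) ?at0"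
    unfolding fresh2_def by (intro tendsto_intros)
  then have fresh2: "(fresh2 P1 P2 N s \<longlongrightarrow> P2) ?at0" by simp
  have strict: "2 * gauss_capacity ((P1 + P2) / N)
      < gauss_capacity (P1 / N) + gauss_capacity (P1 / N)
        + (gauss_capacity (P2 / N) + gauss_capacity (P2 / N))"
    using gauss_capacity_add_less[of "P1 / N" "P2 / N"] params by (simp add: add_divide_distrib)
  have "\<forall>\<^sub>F \<theta> in ?at0. 0 < \<theta> \<and> 0 < fresh1 P1 P2 \<theta> \<and> 0 < fresh2 P1 P2 N s \<theta> \<and>
      \<theta> * ?c < 2 * N * sqrt (P1 * P2) \<and> 2 * gauss_capacity ((P1 + P2) / N) < ?sum \<theta>"
  proof (intro eventually_conj eventually_at_right_less)
    show "\<forall>\<^sub>F \<theta> in ?at0. 0 < fresh1 P1 P2 \<theta>" "\<forall>\<^sub>F \<theta> in ?at0. 0 < fresh2 P1 P2 N s \<theta>"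
      using order_tendstoD(1)[OF fresh1] order_tendstoD(1)[OF fresh2] params by simp_all
    show "\<forall>\<^sub>F \<theta> in ?at0. \<theta> * ?c < 2 * N * sqrt (P1 * P2)"
      using params by (intro order_tendstoD(2)[where y = "0 * ?c"] tendsto_intros) auto
    show "\<forall>\<^sub>F \<theta> in ?at0. 2 * gauss_capacity ((P1 + P2) / N) < ?sum \<theta>"
      using params by (intro order_tendstoD(1)[OF _ strict] tendsto_intros
        tendsto_gauss_capacity_slot2 fresh1 fresh2)
  qed
  then show thesis
    using that eventually_happens'[OF trivial_limit_at_right_real] by blast
qed

lemma correlation_improves_joint_snr:
  assumes "0 < \<theta>" "0 < N" "0 \<le> s"
    and gain: "\<theta> * ((P1 + P2 + N) * s + N * (P1 + P2 + N + 2)) < 2 * N * sqrt (P1 * P2)"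
  shows "(P1 + P2) / N
    < (\<theta>\<^sup>2 * (P1 + P2) + fresh1 P1 P2 \<theta> + fresh2 P1 P2 N s \<theta>) / slot2_noise N s \<theta>"
proof -
  have "\<theta> ^ 3 * (\<theta> * ((P1 + P2 + N) * s + N * (P1 + P2 + N + 2))) < \<theta> ^ 3 * (2 * N * sqrt (P1 * P2))"
    using gain \<open>0 < \<theta>\<close> by (intro mult_strict_left_mono) auto
  then have "(P1 + P2) * slot2_noise N s \<theta>
      < (\<theta>\<^sup>2 * (P1 + P2) + fresh1 P1 P2 \<theta> + fresh2 P1 P2 N s \<theta>) * N"
    unfolding slot2_noise_def fresh1_def fresh2_def by (simp add: eval_nat_numeral algebra_simps)
  moreover have "0 < slot2_noise N s \<theta>"
    using assms by (simp add: slot2_noise_def add_pos_nonneg)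
  ultimately show ?thesis using \<open>0 < N\<close> by (simp add: pos_divide_less_eq pos_less_divide_eq)
qed

lemma C_MAC_sum_rate_exceeded:
  assumes params: "0 < P1" "0 < P2" "0 < N" "0 \<le> s"
  obtains r1 r2 where "0 \<le> r1" "0 \<le> r2" "gauss_capacity ((P1 + P2) / N) < r1 + r2"
    "achievable_fb P1 P2 N s r1 r2"
proof -
  obtain \<theta> where \<theta>_pos: "0 < \<theta>" and fresh_pos: "0 < fresh1 P1 P2 \<theta>" "0 < fresh2 P1 P2 N s \<theta>"
    and gain: "\<theta> * ((P1 + P2 + N) * s + N * (P1 + P2 + N + 2)) < 2 * N * sqrt (P1 * P2)"
    and users: "2 * gauss_capacity ((P1 + P2) / N)
      < gauss_capacity (P1 / N) + gauss_capacity (fresh1 P1 P2 \<theta> / slot2_noise N s \<theta>)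
        + (gauss_capacity (P2 / N) + gauss_capacity (fresh2 P1 P2 N s \<theta> / slot2_noise N s \<theta>))"
    using exists_small_correlation[OF params] by blast
  interpret two_slot_scheme N s "sqrt P1" "sqrt P2" "sqrt (fresh1 P1 P2 \<theta>)" "sqrt (fresh2 P1 P2 N s \<theta>)"
    "- \<theta>" "\<theta>\<^sup>2"
    using params fresh_pos by unfold_locales auto
  have noise: "N' = slot2_noise N s \<theta>"
    by (simp add: N'_def slot2_noise_def flip: power_mult)
  have "(- \<theta> * sqrt P1 + \<theta>\<^sup>2 * sqrt P2)\<^sup>2 = \<theta>\<^sup>2 * P1 - 2 * \<theta> ^ 3 * sqrt (P1 * P2) + \<theta> ^ 4 * P2"
    using params by (simp add: power2_eq_square real_sqrt_mult eval_nat_numeral algebra_simps)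
  then have "pow1 = 2 * P1 - \<theta> ^ 4" "pow2 = 2 * P2 - \<theta> ^ 4"
    unfolding pow1_def pow2_def using params fresh_pos
    by (simp_all add: power_mult_distrib)
      (simp_all add: fresh1_def fresh2_def algebra_simps flip: power_mult)
  then have powers: "pow1 < 2 * P1" "pow2 < 2 * P2" using \<theta>_pos by simp_all
  have "2 * gauss_capacity ((P1 + P2) / N) < info12"
    using correlation_improves_joint_snr[OF \<theta>_pos params(3,4) gain] params fresh_pos
    by (simp add: info12_def noise gauss_capacity_less)
  moreover have "2 * gauss_capacity ((P1 + P2) / N) < info1 + info2"
    using users params fresh_pos by (simp add: info1_def info2_def noise)
  moreover have "0 < info1" "0 < info2"
    using params fresh_pos N'_pos
    by (auto simp: info1_def info2_def intro!: add_pos_pos gauss_capacity_pos)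
  moreover have "0 \<le> 2 * gauss_capacity ((P1 + P2) / N)"
    using params by (intro less_imp_le mult_pos_pos gauss_capacity_pos) auto
  ultimately obtain r1 r2 where "0 \<le> r1" "0 \<le> r2" "2 * r1 < info1" "2 * r2 < info2"
    "2 * (r1 + r2) < info12" "2 * gauss_capacity ((P1 + P2) / N) < 2 * (r1 + r2)"
    using exists_rate_pair[of info1 info2 "2 * gauss_capacity ((P1 + P2) / N)" info12] by blast
  then show thesis using achievable powers by (intro that[of r1 r2]) auto
qed

theorem mainTheorem9:
  fixes P1 P2 N s :: real
  assumes "P1 > 0" and "P2 > 0" and "N > 0" and "s \<ge> 0"
  shows "C_MAC P1 P2 N \<subset> C_NoisyPartialFB P1 P2 N s"
proof -
  obtain r1 r2 where "0 \<le> r1" "0 \<le> r2" and "achievable_fb P1 P2 N s r1 r2"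
    and "gauss_capacity ((P1 + P2) / N) < r1 + r2"
    using C_MAC_sum_rate_exceeded[OF assms] by blast
  then have "(r1, r2) \<in> C_NoisyPartialFB P1 P2 N s" "(r1, r2) \<notin> C_MAC P1 P2 N"
    by (auto simp: C_NoisyPartialFB_def C_MAC_iff)
  then show ?thesis using C_MAC_subset[OF assms] by blast
qed

end
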